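(* Let $n \geq 1$ be an integer, let $\alpha$ be a real number with $0 < \alpha < n$, and let $\mu$ be a (nonnegative, finite) Radon measure on $\mathbf{R}^n$ with compact support. Then $$I_\alpha(\mu) = \frac{1}{(2\pi)^n}\int_{\mathbf{R}^n} \hat k(u)\, \vert \hat \mu(u) \vert^2 \, du,$$ as an identity in $[0,\infty]$, where $$\hat k(u) = \frac{\pi^{n/2}\, 2^{n-\alpha}\, \Gamma\left(\frac{n-\alpha}{2}\right)}{\Gamma\left(\frac{\alpha}{2}\right)}\, \vert u \vert^{\alpha - n}, \qquad u \in \mathbf{R}^n \setminus \{0\}.$$
   Context: $\vert x\vert$ is the Euclidean norm on $\mathbf{R}^n$ and $du$ is Lebesgue measure. The kernel is $k(x) = \vert x\vert^{-\alpha}$ for $x \neq 0$, with $k(0) = \infty$. The $\alpha$-energy of $\mu$ is $$I_\alpha(\mu) = \int\int k(x-y)\, d\mu(x)\, d\mu(y) = \int\int \frac{d\mu(x)\, d\mu(y)}{\vert x-y\vert^\alpha} \in [0,\infty].$$ The Fourier transform of $\mu$ is $\hat\mu(u) = \int e^{iux}\, d\mu(x)$ for $u \in \mathbf{R}^n$, where $ux$ is the Euclidean inner product. $\Gamma(z) = \int_0^\infty t^{z-1} e^{-t}\, dt$ is the gamma function. The function $\hat k$ in the claim is the Fourier transform of $k$ as a tempered distribution, with the conventions $\hat\phi(u) = \int e^{iux}\phi(x)\,dx$ for Schwartz functions $\phi$ and $\langle \hat T, \phi\rangle = \langle T, \hat\phi\rangle$ for tempered distributions $T$. *)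

theory Defs
  imports "HOL-Analysis.Analysis"
begin

definition radon_measure :: "'a::euclidean_space measure \<Rightarrow> bool" where
  "radon_measure M \<longleftrightarrow>
     sets M = sets borel \<and>
     (\<forall>K. compact K \<longrightarrow> emeasure M K < \<infinity>) \<and>
     (\<forall>U. open U \<longrightarrow> emeasure M U = (SUP K\<in>{K. compact K \<and> K \<subseteq> U}. emeasure M K)) \<and>
     (\<forall>A\<in>sets borel. emeasure M A = (INF U\<in>{U. open U \<and> A \<subseteq> U}. emeasure M U))"

definition measure_support :: "'a::topological_space measure \<Rightarrow> 'a set" where
  "measure_support M = {x. \<forall>U. open U \<and> x \<in> U \<longrightarrow> emeasure M U > 0}"

definition riesz_kernel :: "real \<Rightarrow> 'a::euclidean_space \<Rightarrow> ennreal" where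
  "riesz_kernel \<alpha> x = (if x = 0 then \<infinity> else ennreal (norm x powr (- \<alpha>)))"

definition riesz_energy :: "real \<Rightarrow> 'a::euclidean_space measure \<Rightarrow> ennreal" where
  "riesz_energy \<alpha> M = (\<integral>\<^sup>+x. (\<integral>\<^sup>+y. riesz_kernel \<alpha> (x - y) \<partial>M) \<partial>M)"

definition measure_fourier :: "'a::euclidean_space measure \<Rightarrow> 'a \<Rightarrow> complex" where
  "measure_fourier M u = (\<integral>x. exp (\<i> * complex_of_real (u \<bullet> x)) \<partial>M)"

text \<open>Mixed partial derivatives are indexed by lists of basis vectors, differentiating in the
  direction of the head first; a multi-index is a list up to order.\<close>

fun iter_partial :: "'a::euclidean_space list \<Rightarrow> ('a \<Rightarrow> complex) \<Rightarrow> 'a \<Rightarrow> complex" where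
  "iter_partial [] f = f"
| "iter_partial (b # bs) f = iter_partial bs (\<lambda>x. frechet_derivative f (at x) b)"

text \<open>All iterated partial derivatives being everywhere (Frechet) differentiable is the same as
  being infinitely often continuously differentiable.\<close>

definition schwartz :: "('a::euclidean_space \<Rightarrow> complex) set" where
  "schwartz = {\<phi>. \<forall>bs. set bs \<subseteq> Basis \<longrightarrow>
     (\<forall>x. iter_partial bs \<phi> differentiable (at x)) \<and>
     (\<forall>k::nat. bdd_above (range (\<lambda>x. norm x ^ k * norm (iter_partial bs \<phi> x))))}"

definition schwartz_seminorm :: "nat \<Rightarrow> 'a::euclidean_space list \<Rightarrow> ('a \<Rightarrow> complex) \<Rightarrow> real" where
  "schwartz_seminorm k bs \<phi> = (SUP x. norm x ^ k * norm (iter_partial bs \<phi> x))"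

text \<open>A distribution is a functional whose values outside \<^const>\<open>schwartz\<close> are irrelevant.  The
  last clause is continuity for the topology generated by the seminorms.\<close>

definition tempered_distribution :: "(('a::euclidean_space \<Rightarrow> complex) \<Rightarrow> complex) \<Rightarrow> bool" where
  "tempered_distribution T \<longleftrightarrow>
     (\<forall>\<phi>\<in>schwartz. \<forall>\<psi>\<in>schwartz. T (\<lambda>x. \<phi> x + \<psi> x) = T \<phi> + T \<psi>) \<and>
     (\<forall>c. \<forall>\<phi>\<in>schwartz. T (\<lambda>x. c * \<phi> x) = c * T \<phi>) \<and>
     (\<exists>C N. \<forall>\<phi>\<in>schwartz. norm (T \<phi>) \<le>
        C * (\<Sum>k\<le>N. \<Sum>bs\<in>{bs. set bs \<subseteq> Basis \<and> length bs \<le> N}. schwartz_seminorm k bs \<phi>))"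

definition fun_distribution ::
    "('a::euclidean_space \<Rightarrow> complex) \<Rightarrow> ('a \<Rightarrow> complex) \<Rightarrow> complex" where
  "fun_distribution f \<phi> = (\<integral>x. f x * \<phi> x \<partial>lborel)"

definition tempered_function :: "('a::euclidean_space \<Rightarrow> complex) \<Rightarrow> bool" where
  "tempered_function f \<longleftrightarrow>
     (\<forall>\<phi>\<in>schwartz. integrable lborel (\<lambda>x. f x * \<phi> x)) \<and>
     tempered_distribution (fun_distribution f)"

definition fourier :: "('a::euclidean_space \<Rightarrow> complex) \<Rightarrow> 'a \<Rightarrow> complex" where
  "fourier \<phi> u = (\<integral>x. exp (\<i> * complex_of_real (u \<bullet> x)) * \<phi> x \<partial>lborel)"

definition distribution_fourier ::
    "(('a::euclidean_space \<Rightarrow> complex) \<Rightarrow> complex) \<Rightarrow> ('a \<Rightarrow> complex) \<Rightarrow> complex" where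
  "distribution_fourier T \<phi> = T (fourier \<phi>)"

definition has_tempered_fourier ::
    "('a::euclidean_space \<Rightarrow> complex) \<Rightarrow> ('a \<Rightarrow> complex) \<Rightarrow> bool" where
  "has_tempered_fourier f g \<longleftrightarrow>
     tempered_function f \<and> tempered_function g \<and>
     (\<forall>\<phi>\<in>schwartz. distribution_fourier (fun_distribution f) \<phi> = fun_distribution g \<phi>)"

end

theory Submission
  imports Defs "HOL-Probability.Characteristic_Functions"
begin

text \<open>The proof is by subordination: the Riesz kernel is a mixture of Gaussians,
  \<open>norm x powr (- \<alpha>) = (\<integral>t. t powr (\<alpha> / 2 - 1) * exp (- (t * (norm x)\<^sup>2))) / Gamma (\<alpha> / 2)\<close> over \<open>t > 0\<close>
  (\<open>riesz_kernel_subordination\<close>). The Fourier transform of each Gaussian is an explicit Gaussian, and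
  mixing these transforms with the same density gives exactly the stated transform of the kernel
  (\<open>riesz_hat_subordination\<close>); the condition \<open>\<alpha> < n\<close> is what makes this second mixture converge.

  Both claims hold for a single Gaussian in place of the kernel. For the distributional claim this is
  the multiplication formula \<open>\<integral> f g^ = \<integral> f^ g\<close> (\<open>fourier_multiplication_formula\<close>). For the energy it is Fourier
  inversion together with the fact that integrating the character \<open>exp (i u (x - y))\<close> against the
  product measure gives the squared modulus of the transform of the measure (\<open>energy_gaussian\<close>).
  It remains to integrate over the mixing parameter.

  For the energy everything is nonnegative and Tonelli's theorem suffices, so the identity holds in
  \<open>[0, \<infinity>]\<close> (\<open>riesz_energy_fourier\<close>). For the distributional claim, Fubini's theorem requires
  \<open>norm x powr (- \<alpha>) * fourier \<phi> x\<close> to be absolutely integrable. Near the origin the kernel is integrable since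
  \<open>\<alpha> < n\<close>, and at infinity the Fourier transform of a Schwartz function decays faster than any power
  (\<open>fourier_bracket_bound\<close>), because it turns derivatives into multiplication by coordinates
  (\<open>fourier_partial\<close>). The same integrability shows that both functions are tempered
  (\<open>tempered_function_if_riesz_bound\<close>).\<close>

section \<open>Euler integrals\<close>

text \<open>Euler's integral for \<open>Gamma b\<close>, rescaled by \<open>t \<mapsto> a * t\<close>. The finite integrals over the mixing parameter
  below reduce to this one or to its mirror image under \<open>t \<mapsto> 1 / t\<close>.\<close>
lemma nn_integral_power_exp:
  fixes a b :: real
  assumes "a > 0" "b > 0"
  shows "(\<integral>\<^sup>+t. ennreal (indicator {0<..} t * (t powr (b - 1) * exp (- (a * t)))) \<partial>lborel)
           = ennreal (Gamma b * a powr (- b))"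
proof -
  have "(\<integral>\<^sup>+t. ennreal (indicator {0<..} t * (t powr (b - 1) * exp (- (a * t)))) \<partial>lborel)
     = (\<integral>\<^sup>+t. ennreal (a powr (1 - b)) * ennreal (indicator {0..} (a * t) * (a * t) powr (b - 1) / exp (a * t)) \<partial>lborel)"
  proof (rule nn_integral_cong_AE)
    show "AE t in lborel. ennreal (indicator {0<..} t * (t powr (b - 1) * exp (- (a * t))))
      = ennreal (a powr (1 - b)) * ennreal (indicator {0..} (a * t) * (a * t) powr (b - 1) / exp (a * t))"
      using AE_lborel_singleton[of "0::real"]
    proof eventually_elim
      case (elim t)
      have "a powr (1 - b) * a powr (b - 1) = 1" using assms by (simp flip: powr_add)
      then show ?case using assms elim
        by (cases "t > 0") (auto simp: ennreal_mult[symmetric] powr_mult exp_minus field_simps zero_le_mult_iff)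
    qed
  qed
  also have "\<dots> = ennreal (a powr (1 - b)) * (\<integral>\<^sup>+t. ennreal (indicator {0..} (a * t) * (a * t) powr (b - 1) / exp (a * t)) \<partial>lborel)"
    by (rule nn_integral_cmult) measurable
  also have "(\<integral>\<^sup>+t. ennreal (indicator {0..} (a * t) * (a * t) powr (b - 1) / exp (a * t)) \<partial>lborel)
    = ennreal (1 / a) * (ennreal a * (\<integral>\<^sup>+t. ennreal (indicator {0..} (0 + a * t) * (0 + a * t) powr (b - 1) / exp (0 + a * t)) \<partial>lborel))"
    using assms by (simp add: mult.assoc[symmetric] ennreal_mult[symmetric])
  also have "ennreal a * (\<integral>\<^sup>+t. ennreal (indicator {0..} (0 + a * t) * (0 + a * t) powr (b - 1) / exp (0 + a * t)) \<partial>lborel)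
    = ennreal (Gamma b)"
    using Gamma_conv_nn_integral_real[OF assms(2)]
      nn_integral_real_affine[of "\<lambda>t. ennreal (indicator {0..} t * t powr (b - 1) / exp t)" a 0] assms
    by simp
  finally show ?thesis
    using assms by (simp add: ennreal_mult[symmetric] powr_diff powr_minus Gamma_real_pos field_simps)
qed

text \<open>The integral dominates the one with the factor \<open>exp (- (a * t))\<close>, whose value blows up
  as \<open>a\<close> tends to 0. This is what makes the Gaussian mixture infinite at the
  origin, in agreement with the value of the kernel there.\<close>
lemma nn_integral_power_infinite:
  fixes b :: real
  assumes "b > 0"
  shows "(\<integral>\<^sup>+t. ennreal (indicator {0<..} t * t powr (b - 1)) \<partial>lborel) = \<infinity>"
proof (rule ccontr)
  let ?I = "\<integral>\<^sup>+t. ennreal (indicator {0<..} t * t powr (b - 1)) \<partial>lborel"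
  assume "?I \<noteq> \<infinity>"
  then obtain c where c: "c \<ge> 0" "?I = ennreal c" by (cases ?I) auto
  have G: "Gamma b > 0" using assms by (simp add: Gamma_real_pos)
  \<comment> \<open>the solution of \<open>Gamma b * a powr (- b) = c + 1\<close>\<close>
  define a where "a = (Gamma b / (c + 1)) powr (1 / b)"
  have a: "a > 0" using G c(1) by (simp add: a_def)
  have "ennreal (Gamma b * a powr (- b)) \<le> ?I"
    unfolding nn_integral_power_exp[OF a assms, symmetric]
    by (intro nn_integral_mono ennreal_leI) (use a in \<open>auto simp: indicator_def mult_left_le\<close>)
  also have "Gamma b * a powr (- b) = c + 1"
  proof -
    have "g * ((g / (c + 1)) powr (1 / b)) powr (- b) = c + 1" if "g > 0" for g
      using that assms c(1) by (simp add: powr_powr powr_minus_divide)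
    from this[OF G] show ?thesis by (simp add: a_def)
  qed
  finally show False using c by simp
qed

text \<open>The previous Euler integral after the substitution \<open>t \<mapsto> 1 / t\<close>, which turns the
  weight \<open>t powr (b - 1)\<close> into \<open>t powr (- b - 1)\<close>.\<close>
lemma nn_integral_power_exp_inverse:
  fixes a b :: real
  assumes "a > 0" "b > 0"
  shows "(\<integral>\<^sup>+t. ennreal (indicator {0<..} t * (t powr (- b - 1) * exp (- (a / t)))) \<partial>lborel)
           = ennreal (Gamma b * a powr (- b))"
proof -
  let ?f = "\<lambda>t::real. t powr (b - 1) * exp (- (a * t))"
  let ?J = "Gamma b * a powr (- b)"
  have J: "?J \<ge> 0" using assms by (simp add: Gamma_real_pos less_imp_le)
  have "((\<lambda>t. indicator {0<..} t * ?f t) has_integral ?J) UNIV"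
    by (rule nn_integral_has_integral[OF _ _ nn_integral_power_exp[OF assms] J]) auto
  then have "((\<lambda>t. if t \<in> {0<..} then ?f t else 0) has_integral ?J) UNIV"
    by (rule has_integral_eq[rotated]) (auto simp: indicator_def)
  then have "(?f has_integral ?J) {0<..}"
    by (simp only: has_integral_restrict_UNIV)
  then have f: "?f absolutely_integrable_on {0<..} \<and> integral {0<..} ?f = ?J"
    by (auto intro!: nonnegative_absolutely_integrable_1 simp: has_integral_iff)
  have img: "(\<lambda>t::real. 1 / t) ` {0<..} = {0<..}"
  proof -
    have "x \<in> (\<lambda>t::real. 1 / t) ` {0<..}" if "x > 0" for x :: real
      using that by (intro image_eqI[of _ _ "1 / x"]) auto
    then show ?thesis by auto
  qed
  have "(\<lambda>t. \<bar>- 1 / t\<^sup>2\<bar> * ?f (1 / t)) absolutely_integrable_on {0<..} \<and>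
        integral {0<..} (\<lambda>t. \<bar>- 1 / t\<^sup>2\<bar> * ?f (1 / t)) = ?J"
    by (subst has_absolute_integral_change_of_variables_1'[where g = "\<lambda>t. 1 / t"])
       (auto simp: img f inj_on_def power2_eq_square intro!: derivative_eq_intros)
  then have "((\<lambda>t. \<bar>- 1 / t\<^sup>2\<bar> * ?f (1 / t)) has_integral ?J) {0<..}"
    by (auto simp: has_integral_iff set_lebesgue_integral_eq_integral)
  then have "((\<lambda>t. t powr (- b - 1) * exp (- (a / t))) has_integral ?J) {0<..}"
    by (rule has_integral_eq[rotated])
       (auto simp: powr_divide powr_diff powr_minus power2_eq_square field_simps)
  from nn_integral_has_integral_lebesgue[OF _ this] show ?thesis by simp
qed

section \<open>Gaussians and their Fourier transforms\<close>

text \<open>The characteristic function of the standard normal distribution, with the variable scaled by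
  \<open>1 / sqrt (2 * t)\<close>.\<close>
lemma fourier_gaussian_real:
  fixes t u :: real
  assumes "t > 0"
  shows "(\<integral>x. exp (\<i> * complex_of_real (u * x)) * complex_of_real (exp (- (t * x\<^sup>2))) \<partial>lborel)
           = complex_of_real (sqrt (pi / t) * exp (- (u\<^sup>2 / (4 * t))))" (is "?L = _")
proof -
  let ?c = "1 / sqrt (2 * t)"
  have c: "?c > 0" "?c\<^sup>2 = 1 / (2 * t)" using assms by (auto simp: power_divide)
  have "complex_of_real (exp (- ((?c * u)\<^sup>2) / 2)) = char std_normal_distribution (?c * u)"
    by (simp add: char_std_normal_distribution)
  also have "\<dots> = (\<integral>x. std_normal_density x *\<^sub>R exp (\<i> * complex_of_real (?c * u * x)) \<partial>lborel)"
    unfolding char_def by (subst integral_density) (auto simp: normal_density_nonneg mult_ac)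
  also have "\<dots> = (\<integral>x. complex_of_real (1 / sqrt (2 * pi)) * (exp (\<i> * complex_of_real (u * (0 + ?c * x))) *
       complex_of_real (exp (- (t * (0 + ?c * x)\<^sup>2)))) \<partial>lborel)"
  proof (intro Bochner_Integration.integral_cong refl)
    fix x :: real
    have "t * (0 + ?c * x)\<^sup>2 = x\<^sup>2 / 2"
      unfolding add_0 power_mult_distrib c(2) using assms by (simp add: field_simps)
    then show "std_normal_density x *\<^sub>R exp (\<i> * complex_of_real (?c * u * x)) = complex_of_real (1 / sqrt (2 * pi)) * (exp (\<i> * complex_of_real (u * (0 + ?c * x))) *
       complex_of_real (exp (- (t * (0 + ?c * x)\<^sup>2))))"
      by (simp add: std_normal_density_def scaleR_conv_of_real mult_ac)
  qed
  also have "\<dots> = complex_of_real (1 / sqrt (2 * pi)) * (\<integral>x. (exp (\<i> * complex_of_real (u * (0 + ?c * x))) *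
       complex_of_real (exp (- (t * (0 + ?c * x)\<^sup>2)))) \<partial>lborel)"
    by (rule integral_mult_right_zero)
  also have "(\<integral>x. (exp (\<i> * complex_of_real (u * (0 + ?c * x))) *
       complex_of_real (exp (- (t * (0 + ?c * x)\<^sup>2)))) \<partial>lborel) = (1 / ?c) *\<^sub>R ?L"
    using c(1) by (subst (2) lborel_integral_real_affine[where c = ?c and t = 0]) auto
  finally have "complex_of_real (exp (- ((?c * u)\<^sup>2) / 2)) = complex_of_real (1 / sqrt (2 * pi)) * ((1 / ?c) *\<^sub>R ?L)" .
  moreover have "(?c * u)\<^sup>2 / 2 = u\<^sup>2 / (4 * t)"
    unfolding power_mult_distrib c(2) by simp
  ultimately have "complex_of_real (exp (- (u\<^sup>2 / (4 * t)))) = complex_of_real (1 / sqrt (2 * pi)) * ((1 / ?c) *\<^sub>R ?L)"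
    by simp
  then have "complex_of_real (sqrt (2 * pi) * ?c * exp (- (u\<^sup>2 / (4 * t))))
     = complex_of_real (sqrt (2 * pi) * ?c) * (complex_of_real (1 / sqrt (2 * pi)) * ((1 / ?c) *\<^sub>R ?L))"
    by (simp only: of_real_mult)
  also have "\<dots> = complex_of_real (sqrt (2 * pi) * ?c * (1 / sqrt (2 * pi)) * (1 / ?c)) * ?L"
    by (simp only: of_real_mult scaleR_conv_of_real mult_ac)
  also have "sqrt (2 * pi) * ?c * (1 / sqrt (2 * pi)) * (1 / ?c) = 1"
    using assms by simp
  also have "sqrt (2 * pi) * ?c = sqrt (pi / t)"
    by (simp flip: real_sqrt_divide)
  finally show ?thesis by simp
qed

definition gaussian :: "real \<Rightarrow> 'a::euclidean_space \<Rightarrow> real" where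
  "gaussian t x = exp (- (t * (norm x)\<^sup>2))"

text \<open>The Fourier transform of \<open>gaussian t\<close>, and \<open>(2 * pi) ^ DIM('a)\<close> times its
  inverse Fourier transform.\<close>
definition gaussian_hat :: "real \<Rightarrow> 'a::euclidean_space \<Rightarrow> real" where
  "gaussian_hat t u = (pi / t) powr (real DIM('a) / 2) * exp (- ((norm u)\<^sup>2 / (4 * t)))"

lemma integral_lborel_prod:
  fixes f :: "'a::euclidean_space \<Rightarrow> real \<Rightarrow> complex"
  assumes "\<And>b. b \<in> Basis \<Longrightarrow> integrable lborel (f b)"
  shows "(\<integral>x. (\<Prod>b\<in>Basis. f b (x \<bullet> b)) \<partial>lborel) = (\<Prod>b\<in>Basis. \<integral>x. f b x \<partial>lborel)"
proof -
  interpret product_sigma_finite "\<lambda>_::'a. lborel :: real measure" ..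
  have [measurable]: "f b \<in> borel_measurable borel" if "b \<in> Basis" for b
    using borel_measurable_integrable[OF assms[OF that]] by simp
  have "(\<integral>x. (\<Prod>b\<in>Basis. f b (x \<bullet> b)) \<partial>lborel)
      = (\<integral>g. (\<Prod>b\<in>Basis. f b ((\<Sum>c\<in>Basis. g c *\<^sub>R c) \<bullet> b)) \<partial>(\<Pi>\<^sub>M b\<in>(Basis::'a set). lborel))"
    by (subst lborel_eq, subst integral_distr) auto
  also have "\<dots> = (\<integral>g. (\<Prod>b\<in>Basis. f b (g b)) \<partial>(\<Pi>\<^sub>M b\<in>(Basis::'a set). lborel))"
    by (simp cong: prod.cong)
  also have "\<dots> = (\<Prod>b\<in>Basis. \<integral>x. f b x \<partial>lborel)"
    by (rule product_integral_prod) (use assms in auto)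
  finally show ?thesis .
qed

text \<open>A Bochner integral of a non-integrable function is 0 by convention, so a computed nonzero value
  certifies integrability.\<close>
lemma integrable_if_integral_nonzero:
  fixes f :: "'a \<Rightarrow> 'b::{banach, second_countable_topology}"
  shows "integral\<^sup>L M f \<noteq> 0 \<Longrightarrow> integrable M f"
  using not_integrable_integral_eq by blast

text \<open>Both the character and the Gaussian are products over the coordinates, which reduces the claim
  to the line.\<close>
lemma fourier_gaussian:
  fixes u :: "'a::euclidean_space"
  assumes "t > 0"
  shows "fourier (\<lambda>x. complex_of_real (gaussian t x)) u = complex_of_real (gaussian_hat t u)"
proof -
  let ?f = "\<lambda>b x. exp (\<i> * complex_of_real ((u \<bullet> b) * x)) * complex_of_real (exp (- (t * x\<^sup>2)))"
  have int: "integrable lborel (?f b)" for b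
    using fourier_gaussian_real[OF assms, of "u \<bullet> b"] assms
    by (intro integrable_if_integral_nonzero) auto
  have split: "exp (\<i> * complex_of_real (u \<bullet> x)) * complex_of_real (gaussian t x)
      = (\<Prod>b\<in>Basis. ?f b (x \<bullet> b))" for x
  proof -
    have "exp (\<i> * complex_of_real (u \<bullet> x)) = (\<Prod>b\<in>Basis. exp (\<i> * complex_of_real ((u \<bullet> b) * (x \<bullet> b))))"
      by (subst euclidean_inner) (simp add: sum_distrib_left exp_sum)
    moreover have "gaussian t x = (\<Prod>b\<in>Basis. exp (- (t * (x \<bullet> b)\<^sup>2)))"
      unfolding gaussian_def norm_eq_sqrt_inner
      by (subst euclidean_inner) (simp add: sum_nonneg sum_distrib_left power2_eq_square flip: exp_sum sum_negf)
    ultimately show ?thesis by (simp add: prod.distrib)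
  qed
  have "fourier (\<lambda>x. complex_of_real (gaussian t x)) u = (\<Prod>b\<in>Basis. \<integral>x. ?f b x \<partial>lborel)"
    unfolding fourier_def split by (rule integral_lborel_prod) (rule int)
  also have "\<dots> = complex_of_real (\<Prod>b\<in>Basis. sqrt (pi / t) * exp (- ((u \<bullet> b)\<^sup>2 / (4 * t))))"
    by (simp only: fourier_gaussian_real[OF assms] of_real_prod)
  also have "(\<Prod>b\<in>Basis. sqrt (pi / t) * exp (- ((u \<bullet> b)\<^sup>2 / (4 * t)))) = gaussian_hat t u"
  proof -
    have "(pi / t) powr (real DIM('a) / 2) = sqrt (pi / t) ^ DIM('a)"
      using assms by (simp add: powr_realpow[symmetric] powr_half_sqrt[symmetric] powr_powr)
    moreover have "exp (- ((norm u)\<^sup>2 / (4 * t))) = (\<Prod>b\<in>Basis. exp (- ((u \<bullet> b)\<^sup>2 / (4 * t))))"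
      unfolding norm_eq_sqrt_inner
      by (subst euclidean_inner) (simp add: sum_nonneg sum_divide_distrib power2_eq_square flip: exp_sum sum_negf)
    ultimately show ?thesis by (simp add: gaussian_hat_def prod.distrib)
  qed
  finally show ?thesis .
qed

lemma gaussian_measurable [measurable]:
  "(\<lambda>p::real \<times> 'a::euclidean_space. gaussian (fst p) (snd p)) \<in> borel_measurable (borel \<Otimes>\<^sub>M borel)"
  "gaussian t \<in> borel_measurable borel"
  unfolding gaussian_def[abs_def] by measurable

lemma gaussian_hat_measurable [measurable]:
  "(\<lambda>p::real \<times> 'a::euclidean_space. gaussian_hat (fst p) (snd p)) \<in> borel_measurable (borel \<Otimes>\<^sub>M borel)"
  "gaussian_hat t \<in> borel_measurable borel"
  unfolding gaussian_hat_def[abs_def] by measurable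

lemma nn_integral_gaussian:
  assumes "t > 0"
  shows "(\<integral>\<^sup>+(x::'a::euclidean_space). ennreal (gaussian t x) \<partial>lborel) = ennreal ((pi / t) powr (real DIM('a) / 2))"
    and "integrable lborel (gaussian t :: 'a \<Rightarrow> real)"
proof -
  have 1: "(\<integral>(x::'a). complex_of_real (gaussian t x) \<partial>lborel) = complex_of_real ((pi / t) powr (real DIM('a) / 2))"
    using fourier_gaussian[OF assms, of "0::'a"] by (simp add: fourier_def gaussian_hat_def)
  have "integrable lborel (\<lambda>x::'a. complex_of_real (gaussian t x))"
    using 1 assms by (intro integrable_if_integral_nonzero) auto
  then show 2: "integrable lborel (gaussian t :: 'a \<Rightarrow> real)" 
    using complex_of_real_integrable_eq by blast
  show "(\<integral>\<^sup>+(x::'a). ennreal (gaussian t x) \<partial>lborel) = ennreal ((pi / t) powr (real DIM('a) / 2))"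
    using 1 by (subst nn_integral_eq_integral[OF 2]) (auto simp: gaussian_def[abs_def])
qed

text \<open>\<open>gaussian_hat t\<close> is a multiple of the Gaussian with parameter \<open>1 / (4 * t)\<close>, so Fourier
  inversion for Gaussians is a second use of the direct formula.\<close>
lemma inverse_fourier_gaussian_hat:
  fixes x :: "'a::euclidean_space"
  assumes "t > 0"
  shows "(\<integral>u. exp (\<i> * complex_of_real (u \<bullet> x)) * complex_of_real (gaussian_hat t u) \<partial>lborel)
           = complex_of_real ((2 * pi) ^ DIM('a) * gaussian t x)"
    and "integrable lborel (gaussian_hat t :: 'a \<Rightarrow> real)"
proof -
  let ?s = "1 / (4 * t)" and ?k = "(pi / t) powr (real DIM('a) / 2)"
  have s: "?s > 0" using assms by simp
  have eq: "gaussian_hat t = (\<lambda>u::'a. ?k * gaussian ?s u)"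
    by (simp add: fun_eq_iff gaussian_hat_def gaussian_def)
  show "integrable lborel (gaussian_hat t :: 'a \<Rightarrow> real)"
    unfolding eq by (intro integrable_mult_right nn_integral_gaussian(2)[OF s])
  have k: "?k * (pi / ?s) powr (real DIM('a) / 2) = (2 * pi) ^ DIM('a)"
  proof -
    have "?k * (pi / ?s) powr (real DIM('a) / 2) = ((2 * pi)\<^sup>2) powr (real DIM('a) / 2)"
      using assms by (subst powr_mult[symmetric]) (auto simp: power2_eq_square field_simps)
    also have "(2 * pi)\<^sup>2 = (2 * pi) powr 2"
      by simp
    also have "((2 * pi) powr 2) powr (real DIM('a) / 2) = (2 * pi) powr real DIM('a)"
      unfolding powr_powr by simp
    also have "\<dots> = (2 * pi) ^ DIM('a)"
      by (simp add: powr_realpow)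
    finally show ?thesis .
  qed
  have "(\<integral>u. exp (\<i> * complex_of_real (u \<bullet> x)) * complex_of_real (gaussian_hat t u) \<partial>lborel)
     = complex_of_real ?k * (\<integral>u. exp (\<i> * complex_of_real (x \<bullet> u)) * complex_of_real (gaussian ?s u) \<partial>lborel)"
    unfolding eq by (subst integral_mult_right_zero[symmetric]) (simp add: inner_commute mult_ac)
  also have "\<dots> = complex_of_real (?k * gaussian_hat ?s x)"
    using fourier_gaussian[OF s, of x] by (simp add: fourier_def)
  also have "?k * gaussian_hat ?s x = (?k * (pi / ?s) powr (real DIM('a) / 2)) * gaussian t x"
    by (simp add: gaussian_hat_def gaussian_def)
  finally show "(\<integral>u. exp (\<i> * complex_of_real (u \<bullet> x)) * complex_of_real (gaussian_hat t u) \<partial>lborel)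
           = complex_of_real ((2 * pi) ^ DIM('a) * gaussian t x)"
    by (simp only: k)
qed

section \<open>Subordination of the Riesz kernel to Gaussians\<close>

lemma powr_mult_divide_powr:
  fixes t c :: real
  assumes "t > 0" "c \<ge> 0" "a - d = e"
  shows "t powr a * (c / t) powr d = c powr d * t powr e"
  using assms(1,2) by (simp add: powr_divide powr_diff flip: assms(3))

text \<open>The density in \<open>t\<close> for which the Gaussians mix to \<open>norm x powr (- \<alpha>)\<close>.\<close>
definition subordinator :: "real \<Rightarrow> real \<Rightarrow> real" where
  "subordinator \<alpha> t = indicator {0<..} t * t powr (\<alpha> / 2 - 1) / Gamma (\<alpha> / 2)"

definition riesz_hat :: "real \<Rightarrow> 'a::euclidean_space \<Rightarrow> real" where
  "riesz_hat \<alpha> u = pi powr (real DIM('a) / 2) * 2 powr (real DIM('a) - \<alpha>)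
     * Gamma ((real DIM('a) - \<alpha>) / 2) / Gamma (\<alpha> / 2) * norm u powr (\<alpha> - real DIM('a))"

lemma subordinator_measurable [measurable]: "subordinator \<alpha> \<in> borel_measurable borel"
  unfolding subordinator_def[abs_def] by measurable

lemma subordinator_nonneg: "\<alpha> > 0 \<Longrightarrow> subordinator \<alpha> t \<ge> 0"
  by (auto simp: subordinator_def indicator_def Gamma_real_pos less_imp_le)

lemma gaussian_nonneg: "gaussian t x \<ge> 0"
  by (simp add: gaussian_def)

lemma gaussian_hat_nonneg: "gaussian_hat t x \<ge> 0"
  by (simp add: gaussian_hat_def)

text \<open>Euler's integral with \<open>a = (norm x)\<^sup>2\<close> and \<open>b = \<alpha> / 2\<close>. The identity includes the value
  \<open>\<infinity>\<close> at \<open>x = 0\<close>, so that in an energy the diagonal needs no separate treatment.\<close>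
lemma riesz_kernel_subordination:
  fixes x :: "'a::euclidean_space"
  assumes "\<alpha> > 0"
  shows "(\<integral>\<^sup>+t. ennreal (subordinator \<alpha> t * gaussian t x) \<partial>lborel) = riesz_kernel \<alpha> x"
proof -
  let ?b = "\<alpha> / 2"
  have G: "Gamma ?b > 0" using assms by (simp add: Gamma_real_pos)
  then have G0: "Gamma ?b \<noteq> 0" by linarith
  have eq: "(\<integral>\<^sup>+t. ennreal (subordinator \<alpha> t * gaussian t x) \<partial>lborel)
    = (\<integral>\<^sup>+t. ennreal (1 / Gamma ?b) * ennreal (indicator {0<..} t * (t powr (?b - 1) * exp (- ((norm x)\<^sup>2 * t)))) \<partial>lborel)"
    using G by (intro nn_integral_cong) (simp add: subordinator_def gaussian_def ennreal_mult[symmetric] mult_ac)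
  also have "\<dots> = ennreal (1 / Gamma ?b) * (\<integral>\<^sup>+t. ennreal (indicator {0<..} t * (t powr (?b - 1) * exp (- ((norm x)\<^sup>2 * t)))) \<partial>lborel)"
    by (rule nn_integral_cmult) measurable
  also have "\<dots> = riesz_kernel \<alpha> x"
  proof (cases "x = 0")
    case True
    then show ?thesis using nn_integral_power_infinite[of ?b] assms G G0
      by (simp add: riesz_kernel_def ennreal_mult_top del: Gamma_eq_zero_iff)
  next
    case False
    have "(norm x)\<^sup>2 powr (- ?b) = norm x powr (- \<alpha>)"
      using False powr_powr[of "norm x" 2 "- ?b"] by simp
    then show ?thesis
      using False assms nn_integral_power_exp[of "(norm x)\<^sup>2" ?b] G G0
      by (simp add: riesz_kernel_def ennreal_mult[symmetric] del: Gamma_eq_zero_iff)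
  qed
  finally show ?thesis .
qed

text \<open>Mixing the transformed Gaussians with the same density gives the claimed transform of the kernel:
  the powers of \<open>t\<close> combine to \<open>t powr (- (n - \<alpha>) / 2 - 1)\<close> with \<open>n\<close> the dimension, and the mirrored Euler integral
  applies with \<open>a = (norm u)\<^sup>2 / 4\<close>.\<close>
lemma riesz_hat_subordination:
  fixes u :: "'a::euclidean_space"
  assumes "0 < \<alpha>" "\<alpha> < real DIM('a)" "u \<noteq> 0"
  shows "(\<integral>\<^sup>+t. ennreal (subordinator \<alpha> t * gaussian_hat t u) \<partial>lborel) = ennreal (riesz_hat \<alpha> u)"
proof -
  let ?n = "real DIM('a)" and ?a = "(norm u)\<^sup>2 / 4"
  let ?b = "(?n - \<alpha>) / 2"
  let ?K = "pi powr (?n / 2) / Gamma (\<alpha> / 2)"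
  have G: "Gamma (\<alpha> / 2) > 0" using assms by (simp add: Gamma_real_pos)
  have "(\<integral>\<^sup>+t. ennreal (subordinator \<alpha> t * gaussian_hat t u) \<partial>lborel)
    = (\<integral>\<^sup>+t. ennreal ?K * ennreal (indicator {0<..} t * (t powr (- ?b - 1) * exp (- (?a / t)))) \<partial>lborel)"
  proof (rule nn_integral_cong)
    fix t :: real
    have "subordinator \<alpha> t * gaussian_hat t u = ?K * (indicator {0<..} t * (t powr (- ?b - 1) * exp (- (?a / t))))"
    proof (cases "t > 0")
      case True
      have "t powr (\<alpha> / 2 - 1) * (pi / t) powr (?n / 2) = pi powr (?n / 2) * t powr (- ?b - 1)"
        using True by (intro powr_mult_divide_powr) (auto simp: field_simps)
      then show ?thesis using True
        by (simp add: subordinator_def gaussian_hat_def)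
    qed (simp add: subordinator_def)
    then show "ennreal (subordinator \<alpha> t * gaussian_hat t u) = ennreal ?K * ennreal (indicator {0<..} t * (t powr (- ?b - 1) * exp (- (?a / t))))"
      using G by (simp add: ennreal_mult[symmetric])
  qed
  also have "\<dots> = ennreal ?K * (\<integral>\<^sup>+t. ennreal (indicator {0<..} t * (t powr (- ?b - 1) * exp (- (?a / t)))) \<partial>lborel)"
    by (rule nn_integral_cmult) measurable
  also have "\<dots> = ennreal (?K * (Gamma ?b * ?a powr (- ?b)))"
    using assms G by (subst nn_integral_power_exp_inverse) (auto simp: ennreal_mult[symmetric] Gamma_real_pos less_imp_le)
  also have "?a powr (- ?b) = 2 powr (?n - \<alpha>) * norm u powr (\<alpha> - ?n)"
  proof -
    have "?a = (norm u / 2) powr 2" by (simp add: power_divide)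
    moreover have "2 * (- ((?n - \<alpha>) / 2)) = \<alpha> - ?n"
      by (simp add: field_simps)
    ultimately have "?a powr (- ?b) = (norm u / 2) powr (\<alpha> - ?n)"
      by (simp only: powr_powr)
    also have "\<dots> = norm u powr (\<alpha> - ?n) * 2 powr (?n - \<alpha>)"
      using assms(3) by (simp add: powr_divide powr_minus_divide[symmetric] powr_minus[symmetric] divide_powr_uminus)
    finally show ?thesis by simp
  qed
  finally show ?thesis by (simp add: riesz_hat_def mult_ac)
qed

lemma nn_integral_integrable_finite:
  fixes f :: "'a \<Rightarrow> real"
  assumes "f \<in> borel_measurable M" "\<And>x. 0 \<le> f x" "(\<integral>\<^sup>+x. ennreal (f x) \<partial>M) < \<infinity>"
  shows "integrable M f"
  using assms by (intro integrableI_bounded) auto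

section \<open>Integrability of weighted Riesz kernels\<close>

text \<open>The function is again a Gaussian mixture, with density \<open>t powr (n - 1) * exp (- t) / Gamma n\<close>. By
  Tonelli its integral is a multiple of the Euler integral with exponent \<open>n / 2\<close>, where
  \<open>n\<close> is the dimension.\<close>
lemma integrable_bracket_power:
  "integrable lborel (\<lambda>x::'a::euclidean_space. 1 / (1 + (norm x)\<^sup>2) ^ DIM('a))"
proof -
  let ?n = "real DIM('a)"
  let ?F = "\<lambda>(x::'a) t. ennreal (indicator {0<..} t * (t powr (?n - 1) * exp (- ((1 + (norm x)\<^sup>2) * t))))"
  have G: "Gamma ?n > 0" by (simp add: Gamma_real_pos)
  have pos: "1 + (norm x)\<^sup>2 > 0" for x :: 'a by (simp add: add_pos_nonneg)
  have inner: "(\<integral>\<^sup>+t. ?F x t \<partial>lborel) = ennreal (Gamma ?n) * ennreal (1 / (1 + (norm x)\<^sup>2) ^ DIM('a))" for x :: 'a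
    using nn_integral_power_exp[OF pos, of ?n x] pos[of x] G
    by (simp add: ennreal_mult[symmetric] powr_minus_divide powr_realpow less_imp_le)
  have "ennreal (Gamma ?n) * (\<integral>\<^sup>+(x::'a). ennreal (1 / (1 + (norm x)\<^sup>2) ^ DIM('a)) \<partial>lborel)
      = (\<integral>\<^sup>+x. \<integral>\<^sup>+t. ?F x t \<partial>lborel \<partial>lborel)"
    unfolding inner by (rule nn_integral_cmult[symmetric]) measurable
  also have "\<dots> = (\<integral>\<^sup>+t. \<integral>\<^sup>+x. ?F x t \<partial>lborel \<partial>lborel)"
    by (rule lborel_pair.Fubini'[symmetric]) measurable
  also have "\<dots> = (\<integral>\<^sup>+t. ennreal (pi powr (?n / 2)) * ennreal (indicator {0<..} t * (t powr (?n / 2 - 1) * exp (- (1 * t)))) \<partial>lborel)"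
  proof (rule nn_integral_cong)
    fix t :: real
    have "(\<integral>\<^sup>+x. ?F x t \<partial>lborel) = (\<integral>\<^sup>+(x::'a). ennreal (indicator {0<..} t * (t powr (?n - 1) * exp (- t))) * ennreal (gaussian t x) \<partial>lborel)"
      by (intro nn_integral_cong) (simp add: gaussian_def ennreal_mult[symmetric] algebra_simps exp_add exp_diff exp_minus field_simps)
    also have "\<dots> = ennreal (indicator {0<..} t * (t powr (?n - 1) * exp (- t))) * (\<integral>\<^sup>+(x::'a). ennreal (gaussian t x) \<partial>lborel)"
      by (rule nn_integral_cmult) measurable
    also have "\<dots> = ennreal (pi powr (?n / 2)) * ennreal (indicator {0<..} t * (t powr (?n / 2 - 1) * exp (- (1 * t))))"
    proof (cases "t > 0")
      case True
      have "t powr (?n - 1) * (pi / t) powr (?n / 2) = pi powr (?n / 2) * t powr (?n / 2 - 1)"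
        using True by (intro powr_mult_divide_powr) (auto simp: field_simps)
      then show ?thesis using True
        by (simp add: nn_integral_gaussian ennreal_mult[symmetric])
    qed simp
    finally show "(\<integral>\<^sup>+x. ?F x t \<partial>lborel) = ennreal (pi powr (?n / 2)) * ennreal (indicator {0<..} t * (t powr (?n / 2 - 1) * exp (- (1 * t))))" .
  qed
  also have "\<dots> = ennreal (pi powr (?n / 2)) * (\<integral>\<^sup>+t. ennreal (indicator {0<..} t * (t powr (?n / 2 - 1) * exp (- (1 * t)))) \<partial>lborel)"
    by (rule nn_integral_cmult) measurable
  also have "\<dots> < \<infinity>"
    by (subst nn_integral_power_exp) (auto simp: ennreal_mult_less_top)
  finally have "(\<integral>\<^sup>+(x::'a). ennreal (1 / (1 + (norm x)\<^sup>2) ^ DIM('a)) \<partial>lborel) < \<infinity>"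
    using G by (auto simp: ennreal_mult_less_top)
  then show ?thesis
    by (intro nn_integral_integrable_finite) (use pos in \<open>auto simp: less_imp_le\<close>)
qed

text \<open>After subordination and Tonelli the integral is that of
  \<open>t powr (\<beta> / 2 - 1) * (1 + t) powr (- n / 2)\<close> up to a constant. Positivity of \<open>\<beta>\<close> is convergence at
  0, and \<open>\<beta> < n\<close> is convergence at infinity.\<close>
lemma integrable_power_gaussian:
  assumes "0 < \<beta>" "\<beta> < real DIM('a)"
  shows "integrable lborel (\<lambda>x::'a::euclidean_space. norm x powr (- \<beta>) * gaussian 1 x)"
proof -
  let ?n = "real DIM('a)"
  have G: "Gamma (\<beta> / 2) > 0" using assms by (simp add: Gamma_real_pos)
  let ?f = "\<lambda>t::real. indicator {0<..} t * (t powr (\<beta> / 2 - 1) * exp (- (1 * t)))"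
  let ?g = "\<lambda>t::real. indicator {0<..} t * (t powr (- ((?n - \<beta>) / 2) - 1) * exp (- (1 / t)))"
  let ?C = "pi powr (?n / 2) * exp 1 / Gamma (\<beta> / 2)"
  have "(\<integral>\<^sup>+(x::'a). ennreal (norm x powr (- \<beta>) * gaussian 1 x) \<partial>lborel)
      = (\<integral>\<^sup>+(x::'a). \<integral>\<^sup>+t. ennreal (subordinator \<beta> t * gaussian (1 + t) x) \<partial>lborel \<partial>lborel)"
  proof (rule nn_integral_cong_AE)
    show "AE x::'a in lborel. ennreal (norm x powr (- \<beta>) * gaussian 1 x) = (\<integral>\<^sup>+t. ennreal (subordinator \<beta> t * gaussian (1 + t) x) \<partial>lborel)"
      using AE_lborel_singleton[of "0::'a"]
    proof eventually_elim
      case (elim x)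
      have "(\<integral>\<^sup>+t. ennreal (subordinator \<beta> t * gaussian (1 + t) x) \<partial>lborel)
        = (\<integral>\<^sup>+t. ennreal (subordinator \<beta> t * gaussian t x) * ennreal (gaussian 1 x) \<partial>lborel)"
        using assms(1) by (intro nn_integral_cong)
          (simp add: gaussian_def ennreal_mult[symmetric] subordinator_nonneg exp_add[symmetric] algebra_simps)
      also have "\<dots> = (\<integral>\<^sup>+t. ennreal (subordinator \<beta> t * gaussian t x) \<partial>lborel) * ennreal (gaussian 1 x)"
        by (rule nn_integral_multc) (simp add: gaussian_def)
      finally show ?case
        using elim assms by (simp add: riesz_kernel_subordination riesz_kernel_def ennreal_mult gaussian_nonneg)
    qed
  qed
  also have "\<dots> = (\<integral>\<^sup>+t. \<integral>\<^sup>+(x::'a). ennreal (subordinator \<beta> t * gaussian (1 + t) x) \<partial>lborel \<partial>lborel)"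
    unfolding gaussian_def by (rule lborel_pair.Fubini'[symmetric]) measurable
  also have "\<dots> \<le> (\<integral>\<^sup>+t. ennreal ?C * (ennreal (?f t) + ennreal (?g t)) \<partial>lborel)"
  proof (rule nn_integral_mono)
    fix t :: real
    \<comment> \<open>\<open>?f\<close> majorises up to a constant for \<open>t \<le> 1\<close> and \<open>?g\<close> for \<open>t \<ge> 1\<close>; both are Euler integrands\<close>
    have le: "subordinator \<beta> t * (pi / (1 + t)) powr (?n / 2) \<le> ?C * (?f t + ?g t)"
    proof (cases "t > 0")
      case True
      have e: "exp 1 * exp (- s) \<ge> (1::real)" if "s \<le> 1" for s
        using that by (simp flip: exp_add)
      have "t powr (\<beta> / 2 - 1) * (1 / (1 + t)) powr (?n / 2) \<le> exp 1 * (?f t + ?g t)"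
      proof (cases "t \<le> 1")
        case t1: True
        have "(1 / (1 + t)) powr (?n / 2) \<le> 1 powr (?n / 2)"
          using True by (intro powr_mono2) auto
        then have "t powr (\<beta> / 2 - 1) * (1 / (1 + t)) powr (?n / 2) \<le> t powr (\<beta> / 2 - 1) * (exp 1 * exp (- t))"
          using e[OF t1] by (intro mult_left_mono) auto
        also have "\<dots> \<le> exp 1 * (?f t + ?g t)" using True by (simp add: algebra_simps)
        finally show ?thesis .
      next
        case t1: False
        have "(1 / (1 + t)) powr (?n / 2) \<le> (1 / t) powr (?n / 2)"
          using True by (intro powr_mono2) (auto simp: field_simps)
        then have "t powr (\<beta> / 2 - 1) * (1 / (1 + t)) powr (?n / 2) \<le> t powr (\<beta> / 2 - 1) * (1 / t) powr (?n / 2)"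
          by (intro mult_left_mono) auto
        also have "\<dots> = t powr (- ((?n - \<beta>) / 2) - 1)"
          using powr_mult_divide_powr[of t 1 "\<beta> / 2 - 1" "?n / 2" "- ((?n - \<beta>) / 2) - 1"] True
          by (simp add: field_simps)
        also have "\<dots> \<le> t powr (- ((?n - \<beta>) / 2) - 1) * (exp 1 * exp (- (1 / t)))"
          using e[of "1 / t"] t1 mult_left_mono[of 1 "exp 1 * exp (- (1 / t))" "t powr (- ((?n - \<beta>) / 2) - 1)"] by simp
        also have "\<dots> \<le> exp 1 * (?f t + ?g t)" using True by (simp add: algebra_simps)
        finally show ?thesis .
      qed
      then have "pi powr (?n / 2) / Gamma (\<beta> / 2) * (t powr (\<beta> / 2 - 1) * (1 / (1 + t)) powr (?n / 2))
         \<le> pi powr (?n / 2) / Gamma (\<beta> / 2) * (exp 1 * (?f t + ?g t))"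
        using G by (intro mult_left_mono) auto
      then show ?thesis using True
        by (simp add: subordinator_def powr_divide mult_ac)
    qed (simp add: subordinator_def)
    have "(\<integral>\<^sup>+(x::'a). ennreal (subordinator \<beta> t * gaussian (1 + t) x) \<partial>lborel)
       = (\<integral>\<^sup>+(x::'a). ennreal (subordinator \<beta> t) * ennreal (gaussian (1 + t) x) \<partial>lborel)"
      using assms(1) by (simp add: ennreal_mult subordinator_nonneg gaussian_nonneg)
    also have "\<dots> = ennreal (subordinator \<beta> t) * (\<integral>\<^sup>+(x::'a). ennreal (gaussian (1 + t) x) \<partial>lborel)"
      by (rule nn_integral_cmult) measurable
    also have "\<dots> = ennreal (subordinator \<beta> t * (pi / (1 + t)) powr (?n / 2))"
      using assms(1) by (cases "t > 0") (simp_all add: nn_integral_gaussian subordinator_nonneg ennreal_mult, simp add: subordinator_def)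
    also have "\<dots> \<le> ennreal (?C * (?f t + ?g t))"
      using le by (rule ennreal_leI)
    also have "\<dots> = ennreal ?C * (ennreal (?f t) + ennreal (?g t))"
      using G by (subst ennreal_mult) (auto simp: ennreal_plus)
    finally show "(\<integral>\<^sup>+(x::'a). ennreal (subordinator \<beta> t * gaussian (1 + t) x) \<partial>lborel) \<le> ennreal ?C * (ennreal (?f t) + ennreal (?g t))" .
  qed
  also have "\<dots> = ennreal ?C * ((\<integral>\<^sup>+t. ennreal (?f t) \<partial>lborel) + (\<integral>\<^sup>+t. ennreal (?g t) \<partial>lborel))"
    by (subst nn_integral_cmult, measurable, subst nn_integral_add) auto
  also have "\<dots> < \<infinity>"
    using assms by (subst nn_integral_power_exp, simp, simp, subst nn_integral_power_exp_inverse)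
      (auto simp: ennreal_mult_less_top)
  finally show ?thesis
    by (intro nn_integral_integrable_finite) (auto simp: gaussian_nonneg)
qed

text \<open>The unit ball is covered by the Gaussian weight, its complement by the polynomial one.\<close>
lemma integrable_riesz_bracket:
  assumes "0 < \<beta>" "\<beta> < real DIM('a)"
  shows "integrable lborel (\<lambda>x::'a::euclidean_space. norm x powr (- \<beta>) / (1 + (norm x)\<^sup>2) ^ DIM('a))"
proof (rule Bochner_Integration.integrable_bound)
  show "integrable lborel (\<lambda>x::'a. exp 1 * (norm x powr (- \<beta>) * gaussian 1 x) + 1 / (1 + (norm x)\<^sup>2) ^ DIM('a))"
    by (intro Bochner_Integration.integrable_add integrable_mult_right integrable_power_gaussian integrable_bracket_power assms)
  show "AE x::'a in lborel. norm (norm x powr (- \<beta>) / (1 + (norm x)\<^sup>2) ^ DIM('a))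
     \<le> norm (exp 1 * (norm x powr (- \<beta>) * gaussian 1 x) + 1 / (1 + (norm x)\<^sup>2) ^ DIM('a))"
  proof (rule AE_I2)
    fix x :: 'a
    let ?D = "(1 + (norm x)\<^sup>2) ^ DIM('a)"
    have D: "?D \<ge> 1" by (simp add: one_le_power)
    then have D0: "?D > 0" by linarith
    have "norm x powr (- \<beta>) / ?D \<le> exp 1 * (norm x powr (- \<beta>) * gaussian 1 x) + 1 / ?D"
    proof (cases "norm x \<le> 1")
      case True
      have "(norm x)\<^sup>2 \<le> 1" using True by (simp add: power_le_one)
      then have "exp 1 * gaussian 1 x \<ge> 1"
        by (simp add: gaussian_def flip: exp_add)
      then have "norm x powr (- \<beta>) * 1 \<le> norm x powr (- \<beta>) * (exp 1 * gaussian 1 x)"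
        by (intro mult_left_mono) auto
      then have "norm x powr (- \<beta>) \<le> exp 1 * (norm x powr (- \<beta>) * gaussian 1 x)"
        by (simp add: mult_ac)
      moreover have "norm x powr (- \<beta>) / ?D \<le> norm x powr (- \<beta>)"
        using D D0 mult_left_mono[of 1 ?D "norm x powr (- \<beta>)"] by (simp only: pos_divide_le_eq) simp
      moreover have "1 / ?D \<ge> 0" using D by simp
      ultimately show ?thesis by linarith
    next
      case False
      then have "norm x powr (- \<beta>) \<le> 1"
        using powr_mono[of "- \<beta>" 0 "norm x"] assms by (auto split: if_splits)
      then have "norm x powr (- \<beta>) / ?D \<le> 1 / ?D" using D by (intro divide_right_mono) auto
      then show ?thesis by (simp add: gaussian_nonneg add_increasing)
    qed
    then show "norm (norm x powr (- \<beta>) / ?D)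
     \<le> norm (exp 1 * (norm x powr (- \<beta>) * gaussian 1 x) + 1 / ?D)"
      using D by (simp add: gaussian_nonneg)
  qed
qed measurable

section \<open>Schwartz functions and tempered functions\<close>

lemma schwartz_differentiable: "\<phi> \<in> schwartz \<Longrightarrow> \<phi> differentiable (at x)"
  using iter_partial.simps(1)[of \<phi>] unfolding schwartz_def by (force dest: spec[of _ "[]"])

lemma schwartz_measurable: "\<phi> \<in> schwartz \<Longrightarrow> \<phi> \<in> borel_measurable borel"
  by (intro borel_measurable_continuous_onI continuous_at_imp_continuous_on ballI
      differentiable_imp_continuous_within schwartz_differentiable)

text \<open>Iterating this gives decay of all orders of the Fourier transform below.\<close>
lemma schwartz_partial:
  fixes \<phi> :: "'a::euclidean_space \<Rightarrow> complex"
  assumes "\<phi> \<in> schwartz" "b \<in> Basis"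
  shows "(\<lambda>x. frechet_derivative \<phi> (at x) b) \<in> schwartz"
  unfolding schwartz_def
proof (intro CollectI allI impI)
  fix bs :: "'a list" assume "set bs \<subseteq> Basis"
  then have "set (b # bs) \<subseteq> Basis" using assms by simp
  from mp[OF assms(1)[unfolded schwartz_def, THEN CollectD, THEN spec] this]
  show "(\<forall>x. iter_partial bs (\<lambda>x. frechet_derivative \<phi> (at x) b) differentiable (at x)) \<and>
     (\<forall>k::nat. bdd_above (range (\<lambda>x. norm x ^ k * norm (iter_partial bs (\<lambda>x. frechet_derivative \<phi> (at x) b) x))))"
    unfolding iter_partial.simps .
qed

lemma schwartz_seminorm_upper:
  assumes "\<phi> \<in> schwartz" "set bs \<subseteq> Basis"
  shows "norm x ^ k * norm (iter_partial bs \<phi> x) \<le> schwartz_seminorm k bs \<phi>"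
  unfolding schwartz_seminorm_def
  using assms unfolding schwartz_def by (intro cSUP_upper) auto

lemma schwartz_seminorm_nonneg:
  assumes "\<phi> \<in> schwartz" "set bs \<subseteq> Basis"
  shows "schwartz_seminorm k bs \<phi> \<ge> 0"
  by (rule order_trans[OF _ schwartz_seminorm_upper[OF assms, of 0]]) auto

text \<open>The polynomial weight is dominated by the sum of its two extreme monomials, so that just two of
  the seminorms occur.\<close>
lemma schwartz_bracket_bound:
  assumes "\<phi> \<in> schwartz"
  shows "norm (\<phi> x) \<le> 2 ^ m * (schwartz_seminorm 0 [] \<phi> + schwartz_seminorm (2 * m) [] \<phi>) / (1 + (norm x)\<^sup>2) ^ m"
proof -
  have "(1 + (norm x)\<^sup>2) ^ m \<le> 2 ^ m * (1 + norm x ^ (2 * m))"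
  proof (cases "norm x \<le> 1")
    case True
    then have "(1 + (norm x)\<^sup>2) ^ m \<le> 2 ^ m" by (intro power_mono) (auto simp: power_le_one)
    also have "\<dots> \<le> 2 ^ m * (1 + norm x ^ (2 * m))" by simp
    finally show ?thesis .
  next
    case False
    then have "(1 + (norm x)\<^sup>2) ^ m \<le> (2 * (norm x)\<^sup>2) ^ m" by (intro power_mono) auto
    also have "\<dots> \<le> 2 ^ m * (1 + norm x ^ (2 * m))" by (simp add: power_mult_distrib power_mult)
    finally show ?thesis .
  qed
  then have "(1 + (norm x)\<^sup>2) ^ m * norm (\<phi> x) \<le> 2 ^ m * (1 + norm x ^ (2 * m)) * norm (\<phi> x)"
    by (intro mult_right_mono) auto
  also have "\<dots> = 2 ^ m * (norm x ^ 0 * norm (\<phi> x) + norm x ^ (2 * m) * norm (\<phi> x))"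
    by (simp add: algebra_simps)
  also have "\<dots> \<le> 2 ^ m * (schwartz_seminorm 0 [] \<phi> + schwartz_seminorm (2 * m) [] \<phi>)"
    using schwartz_seminorm_upper[OF assms, of "[]" x 0] schwartz_seminorm_upper[OF assms, of "[]" x "2 * m"]
    by (intro mult_left_mono add_mono) auto
  finally show ?thesis
    by (simp add: pos_le_divide_eq add_pos_nonneg mult.commute)
qed

lemma le_norm_real: "a \<le> (r::real) \<Longrightarrow> a \<le> norm r"
  by simp

lemma schwartz_integrable:
  fixes \<phi> :: "'a::euclidean_space \<Rightarrow> complex"
  assumes "\<phi> \<in> schwartz"
  shows "integrable lborel \<phi>"
proof (rule Bochner_Integration.integrable_bound)
  let ?C = "2 ^ DIM('a) * (schwartz_seminorm 0 [] \<phi> + schwartz_seminorm (2 * DIM('a)) [] \<phi>)"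
  show "integrable lborel (\<lambda>x::'a. ?C * (1 / (1 + (norm x)\<^sup>2) ^ DIM('a)))"
    by (intro integrable_mult_right integrable_bracket_power)
  show "AE x in lborel. norm (\<phi> x) \<le> norm (?C * (1 / (1 + (norm x)\<^sup>2) ^ DIM('a)))"
    using schwartz_bracket_bound[OF assms, of _ "DIM('a)"]
    by (intro AE_I2 le_norm_real) simp
qed (use schwartz_measurable[OF assms] in simp)

text \<open>Two seminorms of the test function bound the integrand by a multiple of the integrable weight of
  \<open>integrable_riesz_bracket\<close>, and this single majorant gives both integrability and continuity.\<close>
lemma tempered_function_if_riesz_bound:
  fixes f :: "'a::euclidean_space \<Rightarrow> complex"
  assumes f [measurable]: "f \<in> borel_measurable borel"
    and \<beta>: "0 < \<beta>" "\<beta> < real DIM('a)"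
    and bound: "\<And>x. x \<noteq> 0 \<Longrightarrow> norm (f x) \<le> C * norm x powr (- \<beta>)"
  shows "tempered_function f"
proof -
  let ?m = "DIM('a)"
  let ?w = "\<lambda>x::'a. norm x powr (- \<beta>) / (1 + (norm x)\<^sup>2) ^ ?m"
  let ?S = "\<lambda>\<phi>::'a \<Rightarrow> complex. schwartz_seminorm 0 [] \<phi> + schwartz_seminorm (2 * ?m) [] \<phi>"
  have w: "integrable lborel ?w" by (rule integrable_riesz_bracket[OF \<beta>])
  have C: "C \<ge> 0"
  proof -
    obtain b :: 'a where "b \<in> Basis" using nonempty_Basis by blast
    then show ?thesis using bound[of b] norm_ge_zero[of "f b"] nonzero_Basis[of b] by (auto simp del: norm_ge_zero)
  qed
  have dom: "AE x in lborel. norm (f x * \<phi> x) \<le> C * (2 ^ ?m * ?S \<phi>) * ?w x" if "\<phi> \<in> schwartz" for \<phi>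
    using AE_lborel_singleton[of "0::'a"]
  proof eventually_elim
    case (elim x)
    have "norm (f x * \<phi> x) \<le> (C * norm x powr (- \<beta>)) * (2 ^ ?m * ?S \<phi> / (1 + (norm x)\<^sup>2) ^ ?m)"
      unfolding norm_mult using elim bound C schwartz_bracket_bound[OF that, of x ?m] by (intro mult_mono) auto
    then show ?case by (simp add: mult_ac)
  qed
  have int: "integrable lborel (\<lambda>x. f x * \<phi> x)" if \<phi>: "\<phi> \<in> schwartz" for \<phi>
  proof (rule Bochner_Integration.integrable_bound)
    show "integrable lborel (\<lambda>x. C * (2 ^ ?m * ?S \<phi>) * ?w x)"
      using w by (rule integrable_mult_right)
    show "AE x in lborel. norm (f x * \<phi> x) \<le> norm (C * (2 ^ ?m * ?S \<phi>) * ?w x)"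
      using dom[OF \<phi>] by eventually_elim (rule le_norm_real)
  qed (use schwartz_measurable[OF \<phi>] in measurable)
  have le: "norm (fun_distribution f \<phi>) \<le> C * (2 ^ ?m * ?S \<phi>) * (\<integral>x. ?w x \<partial>lborel)" if \<phi>: "\<phi> \<in> schwartz" for \<phi>
  proof -
    have "norm (fun_distribution f \<phi>) \<le> (\<integral>x. C * (2 ^ ?m * ?S \<phi>) * ?w x \<partial>lborel)"
      unfolding fun_distribution_def
      by (rule order_trans[OF integral_norm_bound integral_mono_AE[OF integrable_norm[OF int[OF \<phi>]] integrable_mult_right[OF w]]])
        (rule dom[OF \<phi>])
    then show ?thesis by (simp only: integral_mult_right_zero)
  qed
  let ?I = "\<integral>x. ?w x \<partial>lborel"
  have I: "?I \<ge> 0" by (intro Bochner_Integration.integral_nonneg) auto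
  define K where "K = C * 2 ^ ?m * 2 * ?I"
  let ?L = "\<lambda>N. {bs::'a list. set bs \<subseteq> Basis \<and> length bs \<le> N}"
  have cont: "norm (fun_distribution f \<phi>) \<le> K * (\<Sum>k\<le>2 * ?m. \<Sum>bs\<in>?L (2 * ?m). schwartz_seminorm k bs \<phi>)"
    if \<phi>: "\<phi> \<in> schwartz" for \<phi>
  proof -
    let ?T = "\<Sum>k\<le>2 * ?m. \<Sum>bs\<in>?L (2 * ?m). schwartz_seminorm k bs \<phi>"
    have fin: "finite (?L (2 * ?m))" by (rule finite_lists_length_le) simp
    have "schwartz_seminorm k [] \<phi> \<le> ?T" if "k \<le> 2 * ?m" for k
    proof -
      have "schwartz_seminorm k [] \<phi> \<le> (\<Sum>bs\<in>?L (2 * ?m). schwartz_seminorm k bs \<phi>)"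
        using fin \<phi> by (intro member_le_sum) (auto intro: schwartz_seminorm_nonneg)
      also have "\<dots> \<le> ?T"
        using that \<phi> by (intro member_le_sum[of k _ "\<lambda>k. \<Sum>bs\<in>?L (2 * ?m). schwartz_seminorm k bs \<phi>"])
          (auto intro!: sum_nonneg schwartz_seminorm_nonneg)
      finally show ?thesis .
    qed
    from this[of 0] this[of "2 * ?m"] have "?S \<phi> \<le> 2 * ?T" by simp
    then have "C * (2 ^ ?m * ?S \<phi>) * ?I \<le> C * (2 ^ ?m * (2 * ?T)) * ?I"
      using C I by (intro mult_right_mono mult_left_mono) auto
    then show ?thesis using le[OF \<phi>] by (simp add: K_def mult_ac)
  qed
  have "tempered_distribution (fun_distribution f)"
    unfolding tempered_distribution_def
  proof (intro conjI ballI allI)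
    fix \<phi> \<psi> :: "'a \<Rightarrow> complex" assume "\<phi> \<in> schwartz" "\<psi> \<in> schwartz"
    then show "fun_distribution f (\<lambda>x. \<phi> x + \<psi> x) = fun_distribution f \<phi> + fun_distribution f \<psi>"
      unfolding fun_distribution_def by (simp add: distrib_left int)
  next
    fix c and \<phi> :: "'a \<Rightarrow> complex"
    show "fun_distribution f (\<lambda>x. c * \<phi> x) = c * fun_distribution f \<phi>"
      unfolding fun_distribution_def by (simp add: mult.left_commute)
  qed (use cont in blast)
  then show ?thesis using int unfolding tempered_function_def by blast
qed

section \<open>Decay of the Fourier transform of a Schwartz function\<close>

lemma fourier_norm_le:
  fixes f :: "'a::euclidean_space \<Rightarrow> complex"
  shows "norm (fourier f u) \<le> (\<integral>x. norm (f x) \<partial>lborel)"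
  unfolding fourier_def by (rule order_trans[OF integral_norm_bound]) (simp add: norm_mult)

lemma fourier_measurable [measurable]:
  fixes f :: "'a::euclidean_space \<Rightarrow> complex"
  assumes [measurable]: "f \<in> borel_measurable borel"
  shows "fourier f \<in> borel_measurable borel"
  unfolding fourier_def[abs_def] by measurable

text \<open>Translation becomes multiplication by a character. This form is used instead of integration by
  parts: difference quotients of translates converge to derivatives.\<close>
lemma fourier_translate:
  fixes f :: "'a::euclidean_space \<Rightarrow> complex"
  assumes [measurable]: "f \<in> borel_measurable borel"
  shows "fourier (\<lambda>x. f (x + h)) u = exp (- (\<i> * complex_of_real (u \<bullet> h))) * fourier f u"
proof -
  let ?g = "\<lambda>y. exp (\<i> * complex_of_real (u \<bullet> (y - h))) * f y"
  have "fourier (\<lambda>x. f (x + h)) u = (\<integral>x. ?g (h + x) \<partial>lborel)"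
    by (simp add: fourier_def add.commute)
  also have "\<dots> = (\<integral>y. ?g y \<partial>distr lborel borel ((+) h))"
    by (rule integral_distr[symmetric]) measurable
  also have "\<dots> = (\<integral>y. exp (- (\<i> * complex_of_real (u \<bullet> h))) * (exp (\<i> * complex_of_real (u \<bullet> y)) * f y) \<partial>lborel)"
    by (simp add: lborel_distr_plus inner_diff_right algebra_simps exp_diff exp_minus field_simps)
  finally show ?thesis by (simp add: fourier_def)
qed

text \<open>The mean value inequality along the segment from \<open>x\<close> to \<open>x + s *\<^sub>R b\<close>. On a segment of length at most 1
  the polynomial weight changes by a bounded factor only, so the derivative can be estimated by its
  decay at \<open>x\<close>. This supplies the integrable majorant for difference quotients.\<close>
lemma schwartz_difference_bound:
  fixes \<phi> :: "'a::euclidean_space \<Rightarrow> complex"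
  assumes "\<phi> \<in> schwartz" "b \<in> Basis"
  shows "\<exists>D. \<forall>x s. \<bar>s\<bar> \<le> 1 \<longrightarrow> norm (\<phi> (x + s *\<^sub>R b) - \<phi> x) \<le> \<bar>s\<bar> * (D / (1 + (norm x)\<^sup>2) ^ DIM('a))"
proof -
  let ?m = "DIM('a)"
  let ?d = "\<lambda>x. frechet_derivative \<phi> (at x) b"
  define D where "D = 2 ^ ?m * (schwartz_seminorm 0 [] ?d + schwartz_seminorm (2 * ?m) [] ?d)"
  have bd: "norm (?d y) \<le> D / (1 + (norm y)\<^sup>2) ^ ?m" for y
    unfolding D_def by (rule schwartz_bracket_bound[OF schwartz_partial[OF assms]])
  have D: "D \<ge> 0" unfolding D_def by (simp add: schwartz_seminorm_nonneg[OF schwartz_partial[OF assms]])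
  have "norm (\<phi> (x + s *\<^sub>R b) - \<phi> x) \<le> \<bar>s\<bar> * (3 ^ ?m * D / (1 + (norm x)\<^sup>2) ^ ?m)" if s: "\<bar>s\<bar> \<le> 1" for x s
  proof -
    let ?\<gamma> = "\<lambda>r. \<phi> (x + r *\<^sub>R b)"
    have der: "(?\<gamma> has_derivative (\<lambda>h. h *\<^sub>R ?d (x + r *\<^sub>R b))) (at r within T)" for r T
    proof -
      have 1: "(\<phi> has_derivative frechet_derivative \<phi> (at (x + r *\<^sub>R b))) (at (x + r *\<^sub>R b))"
        using schwartz_differentiable[OF assms(1)] by (simp add: frechet_derivative_works)
      have 2: "((\<lambda>r. x + r *\<^sub>R b) has_derivative (\<lambda>h. h *\<^sub>R b)) (at r within T)"
        by (auto intro!: derivative_eq_intros)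
      note has_derivative_compose[OF 2 1]
      moreover have "linear (frechet_derivative \<phi> (at (x + r *\<^sub>R b)))"
        using schwartz_differentiable[OF assms(1)] by (rule linear_frechet_derivative)
      ultimately show ?thesis by (simp add: linear_scale)
    qed
    have bound: "norm (?d (x + r *\<^sub>R b)) \<le> 3 ^ ?m * D / (1 + (norm x)\<^sup>2) ^ ?m" if "\<bar>r\<bar> \<le> 1" for r
    proof -
      let ?y = "x + r *\<^sub>R b"
      have "norm x \<le> norm ?y + 1"
        using norm_triangle_ineq4[of ?y "r *\<^sub>R b"] that assms(2) by simp
      then have "(norm x)\<^sup>2 \<le> (norm ?y + 1)\<^sup>2" by (intro power_mono) auto
      also have "\<dots> \<le> 2 * (norm ?y)\<^sup>2 + 2"
        using sum_squares_ge_zero[of "norm ?y - 1" 0] by (simp add: power2_eq_square algebra_simps)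
      finally have "1 + (norm x)\<^sup>2 \<le> 3 * (1 + (norm ?y)\<^sup>2)"
        using zero_le_power2[of "norm ?y"] unfolding distrib_left by linarith
      then have "(1 + (norm x)\<^sup>2) ^ ?m \<le> 3 ^ ?m * (1 + (norm ?y)\<^sup>2) ^ ?m"
        by (metis power_mono power_mult_distrib add_nonneg_nonneg zero_le_one zero_le_power2)
      then have "D * (1 + (norm x)\<^sup>2) ^ ?m \<le> D * (3 ^ ?m * (1 + (norm ?y)\<^sup>2) ^ ?m)"
        using D by (rule mult_left_mono)
      moreover have "d / y \<le> c * d / z" if "d * z \<le> d * (c * y)" "z > 0" "y > 0" for c d y z :: real
        using that by (simp add: field_simps)
      ultimately have "D / (1 + (norm ?y)\<^sup>2) ^ ?m \<le> 3 ^ ?m * D / (1 + (norm x)\<^sup>2) ^ ?m"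
        by (simp add: add_pos_nonneg)
      then show ?thesis using bd[of ?y] by simp
    qed
    have "norm (?\<gamma> s - ?\<gamma> 0) \<le> (3 ^ ?m * D / (1 + (norm x)\<^sup>2) ^ ?m) * norm (s - 0)"
    proof (rule differentiable_bound[where f = ?\<gamma> and S = "{-1..1}" and f' = "\<lambda>r h. h *\<^sub>R ?d (x + r *\<^sub>R b)"])
      show "onorm (\<lambda>h. h *\<^sub>R ?d (x + r *\<^sub>R b)) \<le> 3 ^ ?m * D / (1 + (norm x)\<^sup>2) ^ ?m" if "r \<in> {-1..1}" for r
      proof (rule onorm_le)
        show "norm (h *\<^sub>R ?d (x + r *\<^sub>R b)) \<le> 3 ^ ?m * D / (1 + (norm x)\<^sup>2) ^ ?m * norm h" for h
          using mult_left_mono[OF bound[of r], of "norm h"] that unfolding norm_scaleR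
          by (auto simp: mult.commute)
      qed
    qed (use s in \<open>auto intro: der\<close>)
    then show ?thesis by (simp add: mult.commute)
  qed
  then show ?thesis by blast
qed

lemma has_vector_derivative_quotient:
  assumes "(f has_vector_derivative d) (at 0)"
  shows "((\<lambda>r. (1 / r) *\<^sub>R (f r - f 0)) \<longlongrightarrow> d) (at 0)"
proof -
  have "((\<lambda>h. norm (f h - f 0 - h *\<^sub>R d) / norm h) \<longlongrightarrow> 0) (at 0)"
    using assms unfolding has_vector_derivative_def has_derivative_at by simp
  moreover have "\<forall>\<^sub>F h in at 0. norm (f h - f 0 - h *\<^sub>R d) / norm h = norm ((1 / h) *\<^sub>R (f h - f 0) - d)"
  proof -
    have "norm (f h - f 0 - h *\<^sub>R d) / norm h = norm ((1 / h) *\<^sub>R (f h - f 0) - d)" if "h \<noteq> 0" for h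
    proof -
      have "(1 / h) *\<^sub>R (f h - f 0) - d = (1 / h) *\<^sub>R (f h - f 0 - h *\<^sub>R d)"
        using that by (simp add: scaleR_diff_right)
      then show ?thesis by (simp add: divide_inverse mult.commute)
    qed
    then show ?thesis by (auto simp: eventually_at_filter)
  qed
  ultimately have "((\<lambda>h. norm ((1 / h) *\<^sub>R (f h - f 0) - d)) \<longlongrightarrow> 0) (at 0)"
    by (rule Lim_transform_eventually)
  then show ?thesis by (rule LIM_zero_cancel[OF tendsto_norm_zero_cancel])
qed

text \<open>The Fourier transform of a difference quotient along \<open>b\<close> is computed by translation, and tends
  to that of the derivative by dominated convergence.\<close>
lemma fourier_partial:
  fixes \<phi> :: "'a::euclidean_space \<Rightarrow> complex"
  assumes \<phi>: "\<phi> \<in> schwartz" and b: "b \<in> Basis"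
  shows "fourier (\<lambda>x. frechet_derivative \<phi> (at x) b) u = - \<i> * complex_of_real (u \<bullet> b) * fourier \<phi> u"
proof -
  let ?d = "\<lambda>x. frechet_derivative \<phi> (at x) b"
  obtain D where D: "\<And>x s. \<bar>s\<bar> \<le> 1 \<Longrightarrow> norm (\<phi> (x + s *\<^sub>R b) - \<phi> x) \<le> \<bar>s\<bar> * (D / (1 + (norm x)\<^sup>2) ^ DIM('a))"
    using schwartz_difference_bound[OF assms] by blast
  define s where "s = (\<lambda>i::nat. 1 / real (Suc i))"
  have s: "s i > 0" "s i \<le> 1" for i by (simp_all add: s_def)
  have slim: "s \<longlonglongrightarrow> 0" unfolding s_def using LIMSEQ_inverse_real_of_nat by (simp add: inverse_eq_divide)
  have sat: "filterlim s (at 0) sequentially"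
    unfolding filterlim_at using slim s by (auto simp: less_imp_neq[symmetric] intro!: always_eventually less_imp_neq[THEN not_sym])
  have [measurable]: "\<phi> \<in> borel_measurable borel" "?d \<in> borel_measurable borel"
    using schwartz_measurable[OF \<phi>] schwartz_measurable[OF schwartz_partial[OF assms]] by auto
  let ?q = "\<lambda>i x. (1 / s i) *\<^sub>R (\<phi> (x + s i *\<^sub>R b) - \<phi> x)"
  have lim1: "(\<lambda>i. fourier (?q i) u) \<longlonglongrightarrow> fourier ?d u"
    unfolding fourier_def
  proof (rule integral_dominated_convergence[where w = "\<lambda>x. D * (1 / (1 + (norm x)\<^sup>2) ^ DIM('a))"])
    show "integrable lborel (\<lambda>x::'a. D * (1 / (1 + (norm x)\<^sup>2) ^ DIM('a)))"
      by (intro integrable_mult_right integrable_bracket_power)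
    show "AE x in lborel. (\<lambda>i. exp (\<i> * complex_of_real (u \<bullet> x)) * ?q i x) \<longlonglongrightarrow> exp (\<i> * complex_of_real (u \<bullet> x)) * ?d x"
    proof (intro AE_I2 tendsto_mult tendsto_const)
      fix x
      have "(\<phi> has_derivative frechet_derivative \<phi> (at x)) (at x)"
        using schwartz_differentiable[OF \<phi>] by (simp add: frechet_derivative_works)
      then have "((\<lambda>r. \<phi> (x + r *\<^sub>R b)) has_derivative (\<lambda>r. frechet_derivative \<phi> (at x) (r *\<^sub>R b))) (at 0)"
        by (intro has_derivative_compose[where g = \<phi> and f = "\<lambda>r. x + r *\<^sub>R b"]) (auto intro!: derivative_eq_intros)
      moreover have "linear (frechet_derivative \<phi> (at x))"
        using schwartz_differentiable[OF \<phi>] by (rule linear_frechet_derivative)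
      ultimately have "((\<lambda>r. \<phi> (x + r *\<^sub>R b)) has_vector_derivative ?d x) (at 0)"
        by (simp add: has_vector_derivative_def linear_scale)
      from has_vector_derivative_quotient[OF this]
      have "((\<lambda>r. (1 / r) *\<^sub>R (\<phi> (x + r *\<^sub>R b) - \<phi> x)) \<longlongrightarrow> ?d x) (at 0)"
        by simp
      from filterlim_compose[OF this sat] show "(\<lambda>i. ?q i x) \<longlonglongrightarrow> ?d x" .
    qed
    show "AE x in lborel. norm (exp (\<i> * complex_of_real (u \<bullet> x)) * ?q i x) \<le> D * (1 / (1 + (norm x)\<^sup>2) ^ DIM('a))" for i
    proof (rule AE_I2)
      fix x
      have "norm (?q i x) \<le> (1 / s i) * (s i * (D / (1 + (norm x)\<^sup>2) ^ DIM('a)))"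
        using D[of "s i" x] s[of i] by (simp only: norm_scaleR) (intro mult_mono, auto)
      then show "norm (exp (\<i> * complex_of_real (u \<bullet> x)) * ?q i x) \<le> D * (1 / (1 + (norm x)\<^sup>2) ^ DIM('a))"
        using s[of i] by (simp add: norm_mult)
    qed
  qed measurable
  have int: "integrable lborel (\<lambda>x. exp (\<i> * complex_of_real (u \<bullet> x)) * \<psi> x)" if "integrable lborel \<psi>" for \<psi> :: "'a \<Rightarrow> complex"
    by (rule Bochner_Integration.integrable_bound[OF that]) (use borel_measurable_integrable[OF that] in \<open>auto simp: norm_mult\<close>)
  have i1: "integrable lborel \<phi>" using \<phi> by (rule schwartz_integrable)
  have i2: "integrable lborel (\<lambda>x. \<phi> (x + h))" for h
  proof -
    have "integrable (distr lborel borel ((+) h)) \<phi>" using i1 by (simp add: lborel_distr_plus)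
    then show ?thesis by (subst (asm) integrable_distr_eq) (auto simp: add.commute)
  qed
  have q: "fourier (?q i) u = (exp (- (\<i> * complex_of_real (s i * (u \<bullet> b)))) - 1) / complex_of_real (s i) * fourier \<phi> u" for i
  proof -
    have "fourier (?q i) u = (1 / s i) *\<^sub>R (fourier (\<lambda>x. \<phi> (x + s i *\<^sub>R b)) u - fourier \<phi> u)"
      unfolding fourier_def using int[OF i1] int[OF i2]
      by (simp add: right_diff_distrib)
    then show ?thesis
      using s(1)[of i] by (simp add: fourier_translate scaleR_conv_of_real field_simps)
  qed
  let ?e = "\<lambda>z. exp (- (\<i> * (z * complex_of_real (u \<bullet> b))))"
  have "(?e has_field_derivative - \<i> * complex_of_real (u \<bullet> b)) (at (complex_of_real 0))"
    by (auto intro!: derivative_eq_intros)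
  from has_vector_derivative_quotient[OF has_vector_derivative_real_field[OF this]]
  have "((\<lambda>r. (exp (- (\<i> * complex_of_real (r * (u \<bullet> b)))) - 1) / complex_of_real r)
      \<longlongrightarrow> - \<i> * complex_of_real (u \<bullet> b)) (at 0)"
    by (simp add: scaleR_conv_of_real divide_inverse mult.commute)
  from tendsto_mult_right[OF filterlim_compose[OF this sat]]
  have "(\<lambda>i. fourier (?q i) u) \<longlonglongrightarrow> - \<i> * complex_of_real (u \<bullet> b) * fourier \<phi> u"
    unfolding q .
  with lim1 show ?thesis by (rule LIMSEQ_unique)
qed

text \<open>Each factor \<open>u \<bullet> b\<close> is absorbed by a derivative of \<open>\<phi>\<close> along \<open>b\<close>, and the transform of an integrable
  function is bounded.\<close>
lemma fourier_iterated_bound: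
  fixes \<phi> :: "'a::euclidean_space \<Rightarrow> complex"
  assumes "\<phi> \<in> schwartz" and b: "b \<in> Basis"
  shows "\<exists>C. \<forall>u. \<bar>u \<bullet> b\<bar> ^ k * norm (fourier \<phi> u) \<le> C"
  using assms(1)
proof (induction k arbitrary: \<phi>)
  case 0
  show ?case by (intro exI[of _ "\<integral>x. norm (\<phi> x) \<partial>lborel"]) (simp add: fourier_norm_le)
next
  case (Suc k)
  have eq: "\<bar>u \<bullet> b\<bar> ^ Suc k * norm (fourier \<phi> u) = \<bar>u \<bullet> b\<bar> ^ k * norm (fourier (\<lambda>x. frechet_derivative \<phi> (at x) b) u)" for u
    by (simp add: fourier_partial[OF Suc.prems b] norm_mult)
  from Suc.IH[OF schwartz_partial[OF Suc.prems b]] show ?case unfolding eq .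
qed

text \<open>The largest coordinate, or 1 if all coordinates are smaller, dominates the left side.\<close>
lemma bracket_le_sum_coordinates:
  fixes u :: "'a::euclidean_space"
  shows "(1 + (norm u)\<^sup>2) ^ m \<le> (real DIM('a) + 1) ^ m * (1 + (\<Sum>b\<in>Basis. \<bar>u \<bullet> b\<bar> ^ (2 * m)))"
proof -
  define M where "M = Max (insert 1 ((\<lambda>b. \<bar>u \<bullet> b\<bar>) ` Basis))"
  have fin: "finite (insert 1 ((\<lambda>b. \<bar>u \<bullet> b\<bar>) ` Basis))" by simp
  have M1: "M \<ge> 1" and Mb: "\<And>b. b \<in> Basis \<Longrightarrow> \<bar>u \<bullet> b\<bar> \<le> M"
    unfolding M_def by (rule Max_ge[OF fin], simp)+
  have "(norm u)\<^sup>2 = (\<Sum>b\<in>Basis. (u \<bullet> b)\<^sup>2)"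
    unfolding norm_eq_sqrt_inner by (subst euclidean_inner) (simp add: sum_nonneg power2_eq_square)
  also have "\<dots> \<le> (\<Sum>b\<in>(Basis::'a set). M\<^sup>2)"
    by (intro sum_mono) (metis Mb abs_ge_zero power2_abs power_mono)
  finally have "1 + (norm u)\<^sup>2 \<le> (real DIM('a) + 1) * M\<^sup>2"
    using one_le_power[OF M1, of 2] by (simp add: algebra_simps)
  then have "(1 + (norm u)\<^sup>2) ^ m \<le> ((real DIM('a) + 1) * M\<^sup>2) ^ m"
    by (intro power_mono) auto
  also have "\<dots> = (real DIM('a) + 1) ^ m * M ^ (2 * m)"
    by (simp add: power_mult_distrib power_mult)
  also have "M ^ (2 * m) \<le> 1 + (\<Sum>b\<in>Basis. \<bar>u \<bullet> b\<bar> ^ (2 * m))"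
  proof -
    have "M \<in> insert 1 ((\<lambda>b. \<bar>u \<bullet> b\<bar>) ` Basis)"
      unfolding M_def by (rule Max_in) auto
    then consider "M = 1" | b where "b \<in> Basis" "M = \<bar>u \<bullet> b\<bar>" by blast
    then show ?thesis
    proof cases
      case 1
      then show ?thesis by (simp add: sum_nonneg)
    next
      case 2
      then have "M ^ (2 * m) \<le> (\<Sum>b\<in>Basis. \<bar>u \<bullet> b\<bar> ^ (2 * m))"
        by (auto intro!: member_le_sum[of b])
      then show ?thesis by simp
    qed
  qed
  finally show ?thesis by (simp add: mult_left_mono)
qed

text \<open>Powers of single coordinates control powers of the norm. This decay makes the pairing of the
  kernel with \<open>fourier \<phi>\<close> absolutely convergent.\<close>
lemma fourier_bracket_bound:
  fixes \<phi> :: "'a::euclidean_space \<Rightarrow> complex"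
  assumes \<phi>: "\<phi> \<in> schwartz"
  shows "\<exists>C. \<forall>u. norm (fourier \<phi> u) \<le> C / (1 + (norm u)\<^sup>2) ^ m"
proof -
  have "\<forall>b\<in>Basis. \<exists>C. \<forall>u. \<bar>u \<bullet> b\<bar> ^ (2 * m) * norm (fourier \<phi> u) \<le> C"
    using fourier_iterated_bound[OF \<phi>] by blast
  then obtain C where C: "\<And>b u. b \<in> Basis \<Longrightarrow> \<bar>u \<bullet> b\<bar> ^ (2 * m) * norm (fourier \<phi> u) \<le> C b"
    by metis
  define K where "K = (real DIM('a) + 1) ^ m * ((\<integral>x. norm (\<phi> x) \<partial>lborel) + (\<Sum>b\<in>Basis. C b))"
  have "norm (fourier \<phi> u) \<le> K / (1 + (norm u)\<^sup>2) ^ m" for u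
  proof -
    have "(1 + (norm u)\<^sup>2) ^ m * norm (fourier \<phi> u)
       \<le> (real DIM('a) + 1) ^ m * (1 + (\<Sum>b\<in>Basis. \<bar>u \<bullet> b\<bar> ^ (2 * m))) * norm (fourier \<phi> u)"
      by (intro mult_right_mono bracket_le_sum_coordinates) auto
    also have "\<dots> = (real DIM('a) + 1) ^ m * (norm (fourier \<phi> u) + (\<Sum>b\<in>Basis. \<bar>u \<bullet> b\<bar> ^ (2 * m) * norm (fourier \<phi> u)))"
      by (simp add: algebra_simps sum_distrib_left)
    also have "\<dots> \<le> K"
      unfolding K_def using C by (intro mult_left_mono add_mono sum_mono fourier_norm_le) auto
    finally show ?thesis
      by (simp add: pos_le_divide_eq add_pos_nonneg mult.commute)
  qed
  then show ?thesis by blast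
qed

section \<open>The Fourier transform of the Riesz kernel\<close>

text \<open>Fubini for a kernel \<open>K\<close> that is a mixture of nonnegative kernels \<open>A t\<close>: absolute convergence of
  the pairing of \<open>K\<close> with \<open>\<psi>\<close> suffices, because no cancellation occurs in the
  mixture. The identity for \<open>K\<close> is asked for off the origin, where the Riesz kernel is finite.\<close>
lemma integral_gaussian_mixture:
  fixes w :: "real \<Rightarrow> real" and A :: "real \<Rightarrow> 'a::euclidean_space \<Rightarrow> real"
    and K :: "'a \<Rightarrow> real" and \<psi> :: "'a \<Rightarrow> complex"
  assumes [measurable]: "w \<in> borel_measurable borel" "(\<lambda>p. A (fst p) (snd p)) \<in> borel_measurable (borel \<Otimes>\<^sub>M borel)"
      "\<psi> \<in> borel_measurable borel"
    and nn: "\<And>t. 0 \<le> w t" "\<And>t x. 0 \<le> A t x"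
    and mix: "\<And>x. x \<noteq> 0 \<Longrightarrow> (\<integral>\<^sup>+t. ennreal (w t * A t x) \<partial>lborel) = ennreal (K x)"
    and K: "\<And>x. 0 \<le> K x"
    and int: "integrable lborel (\<lambda>x. complex_of_real (K x) * \<psi> x)"
  shows "(\<integral>x. complex_of_real (K x) * \<psi> x \<partial>lborel)
       = (\<integral>t. complex_of_real (w t) * (\<integral>x. complex_of_real (A t x) * \<psi> x \<partial>lborel) \<partial>lborel)"
proof -
  let ?F = "\<lambda>t x. complex_of_real (w t) * (complex_of_real (A t x) * \<psi> x)"
  have [measurable]: "(\<lambda>p. A (snd p) (fst p)) \<in> borel_measurable (borel \<Otimes>\<^sub>M borel)"
    using measurable_compose[OF measurable_Pair[OF measurable_snd measurable_fst] assms(2)] by simp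
  have slice: "integrable lborel (\<lambda>t. w t * A t x) \<and> (\<integral>t. w t * A t x \<partial>lborel) = K x" if "x \<noteq> 0" for x
  proof -
    have [measurable]: "(\<lambda>t. A t x) \<in> borel_measurable borel"
      using measurable_compose[of "\<lambda>t. (t, x)" borel _ _ borel, OF _ assms(2)] by simp
    show ?thesis
      using mix[OF that] K[of x] nn
      by (subst integral_eq_nn_integral) (auto intro!: integrableI_nonneg)
  qed
  have prod: "integrable (lborel \<Otimes>\<^sub>M lborel) (\<lambda>(x, t). ?F t x)"
  proof (rule lborel_pair.Fubini_integrable)
    show "(\<lambda>(x, t). ?F t x) \<in> borel_measurable (lborel \<Otimes>\<^sub>M lborel)"
      by (simp add: case_prod_beta)
    show "integrable lborel (\<lambda>x. \<integral>t. norm (case (x, t) of (x, t) \<Rightarrow> ?F t x) \<partial>lborel)"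
    proof (rule integrable_cong_AE_imp[OF integrable_norm[OF int]])
      show "AE x in lborel. norm (complex_of_real (K x) * \<psi> x) = (\<integral>t. norm (case (x, t) of (x, t) \<Rightarrow> ?F t x) \<partial>lborel)"
        using AE_lborel_singleton[of "0::'a"]
      proof eventually_elim
        case (elim x)
        have "(\<integral>t. norm (case (x, t) of (x, t) \<Rightarrow> ?F t x) \<partial>lborel) = (\<integral>t. (w t * A t x) * norm (\<psi> x) \<partial>lborel)"
          using nn by (simp add: norm_mult mult_ac)
        then show ?case using slice[OF elim] K[of x] by (simp add: norm_mult)
      qed
    qed (simp add: case_prod_beta)
    show "AE x in lborel. integrable lborel (\<lambda>t. case (x, t) of (x, t) \<Rightarrow> ?F t x)"
      using AE_lborel_singleton[of "0::'a"]
    proof eventually_elim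
      case (elim x)
      have "integrable lborel (\<lambda>t. complex_of_real (w t * A t x))"
        unfolding complex_of_real_integrable_eq using slice[OF elim] by blast
      then have "integrable lborel (\<lambda>t. complex_of_real (w t * A t x) * \<psi> x)"
        by (rule integrable_mult_left)
      then show ?case by (simp add: mult.assoc)
    qed
  qed
  have "(\<integral>x. complex_of_real (K x) * \<psi> x \<partial>lborel) = (\<integral>x. (\<integral>t. ?F t x \<partial>lborel) \<partial>lborel)"
  proof (rule integral_cong_AE)
    show "AE x in lborel. complex_of_real (K x) * \<psi> x = (\<integral>t. ?F t x \<partial>lborel)"
      using AE_lborel_singleton[of "0::'a"]
    proof eventually_elim
      case (elim x)
      have "(\<integral>t. ?F t x \<partial>lborel) = (\<integral>t. complex_of_real (w t * A t x) * \<psi> x \<partial>lborel)"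
        by (simp add: mult.assoc)
      also have "\<dots> = complex_of_real (\<integral>t. w t * A t x \<partial>lborel) * \<psi> x"
        by (simp del: of_real_mult)
      finally show ?case using slice[OF elim] by simp
    qed
  qed (use borel_measurable_integrable[OF int] in simp, measurable)
  also have "\<dots> = (\<integral>t. (\<integral>x. ?F t x \<partial>lborel) \<partial>lborel)"
    using lborel_pair.Fubini_integral[OF prod] by simp
  finally show ?thesis by simp
qed

text \<open>Both sides are the double integral of \<open>f x * g u\<close> against the symmetric kernel
  \<open>exp (\<i> * complex_of_real (x \<bullet> u))\<close>.\<close>
lemma fourier_multiplication_formula:
  fixes f g :: "'a::euclidean_space \<Rightarrow> complex"
  assumes f: "integrable lborel f" and g: "integrable lborel g"
  shows "(\<integral>x. f x * fourier g x \<partial>lborel) = (\<integral>u. fourier f u * g u \<partial>lborel)"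
proof -
  have [measurable]: "f \<in> borel_measurable borel" "g \<in> borel_measurable borel"
    using f g by auto
  let ?F = "\<lambda>x u. f x * (exp (\<i> * complex_of_real (x \<bullet> u)) * g u)"
  have gint: "integrable lborel (\<lambda>u. exp (\<i> * complex_of_real (x \<bullet> u)) * g u)" for x
    by (rule Bochner_Integration.integrable_bound[OF g]) (auto simp: norm_mult)
  have prod: "integrable (lborel \<Otimes>\<^sub>M lborel) (\<lambda>(x, u). ?F x u)"
  proof (rule lborel_pair.Fubini_integrable)
    show "integrable lborel (\<lambda>x. \<integral>u. norm (case (x, u) of (x, u) \<Rightarrow> ?F x u) \<partial>lborel)"
      using f by (simp add: norm_mult)
  qed (auto intro!: gint)
  have "(\<integral>x. f x * fourier g x \<partial>lborel) = (\<integral>x. (\<integral>u. ?F x u \<partial>lborel) \<partial>lborel)"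
    by (simp add: fourier_def)
  also have "\<dots> = (\<integral>u. (\<integral>x. ?F x u \<partial>lborel) \<partial>lborel)"
    using lborel_pair.Fubini_integral[OF prod] by simp
  also have "\<dots> = (\<integral>u. fourier f u * g u \<partial>lborel)"
    unfolding fourier_def
    by (intro Bochner_Integration.integral_cong refl, subst integral_mult_left_zero[symmetric])
       (simp add: inner_commute mult_ac)
  finally show ?thesis .
qed

lemma riesz_hat_nonneg:
  assumes "0 < \<alpha>" "\<alpha> < real DIM('a)"
  shows "riesz_hat \<alpha> (u::'a::euclidean_space) \<ge> 0"
  using assms by (auto simp: riesz_hat_def intro!: mult_nonneg_nonneg divide_nonneg_nonneg less_imp_le[OF Gamma_real_pos])

lemma riesz_hat_measurable [measurable]: "riesz_hat \<alpha> \<in> borel_measurable borel"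
  unfolding riesz_hat_def[abs_def] by measurable

lemma tempered_riesz:
  assumes "0 < \<alpha>" "\<alpha> < real DIM('a)"
  shows "tempered_function (\<lambda>x::'a::euclidean_space. complex_of_real (norm x powr (- \<alpha>)))"
    and "tempered_function (\<lambda>u::'a::euclidean_space. complex_of_real (riesz_hat \<alpha> u))"
proof -
  show "tempered_function (\<lambda>x::'a::euclidean_space. complex_of_real (norm x powr (- \<alpha>)))"
    by (rule tempered_function_if_riesz_bound[where C = 1, OF _ assms]) auto
  have "norm (complex_of_real (riesz_hat \<alpha> u)) \<le> pi powr (real DIM('a) / 2) * 2 powr (real DIM('a) - \<alpha>)
     * Gamma ((real DIM('a) - \<alpha>) / 2) / Gamma (\<alpha> / 2) * norm u powr (- (real DIM('a) - \<alpha>))" for u :: 'a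
    unfolding norm_of_real abs_of_nonneg[OF riesz_hat_nonneg[OF assms]] by (simp add: riesz_hat_def)
  from tempered_function_if_riesz_bound[OF _ _ _ this]
  show "tempered_function (\<lambda>u::'a::euclidean_space. complex_of_real (riesz_hat \<alpha> u))"
    using assms by simp
qed

text \<open>Decompose the kernel into Gaussians, move the Fourier transform from the test function to each
  Gaussian, and recombine.\<close>
lemma fourier_riesz:
  fixes \<phi> :: "'a::euclidean_space \<Rightarrow> complex"
  assumes \<alpha>: "0 < \<alpha>" "\<alpha> < real DIM('a)" and \<phi>: "\<phi> \<in> schwartz"
  shows "(\<integral>x. complex_of_real (norm x powr (- \<alpha>)) * fourier \<phi> x \<partial>lborel)
       = (\<integral>u. complex_of_real (riesz_hat \<alpha> u) * \<phi> u \<partial>lborel)"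
proof -
  have [measurable]: "\<phi> \<in> borel_measurable borel" using \<phi> by (rule schwartz_measurable)
  obtain C where C: "\<And>u. norm (fourier \<phi> u) \<le> C / (1 + (norm u)\<^sup>2) ^ DIM('a)"
    using fourier_bracket_bound[OF \<phi>] by blast
  have int: "integrable lborel (\<lambda>x. complex_of_real (norm x powr (- \<alpha>)) * fourier \<phi> x)"
  proof (rule Bochner_Integration.integrable_bound)
    show "integrable lborel (\<lambda>x::'a. C * (norm x powr (- \<alpha>) / (1 + (norm x)\<^sup>2) ^ DIM('a)))"
      by (intro integrable_mult_right integrable_riesz_bracket \<alpha>)
    show "AE x in lborel. norm (complex_of_real (norm x powr (- \<alpha>)) * fourier \<phi> x)
       \<le> norm (C * (norm x powr (- \<alpha>) / (1 + (norm x)\<^sup>2) ^ DIM('a)))"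
    proof (rule AE_I2)
      fix x
      have "norm (complex_of_real (norm x powr (- \<alpha>)) * fourier \<phi> x) \<le> norm x powr (- \<alpha>) * (C / (1 + (norm x)\<^sup>2) ^ DIM('a))"
        using C[of x] by (simp only: norm_mult) (intro mult_mono, auto)
      also have "\<dots> \<le> norm (C * (norm x powr (- \<alpha>) / (1 + (norm x)\<^sup>2) ^ DIM('a)))"
        by (rule order_trans[OF _ abs_ge_self[of "C * (norm x powr (- \<alpha>) / (1 + (norm x)\<^sup>2) ^ DIM('a))", folded real_norm_def]]) (simp add: mult_ac)
      finally show "norm (complex_of_real (norm x powr (- \<alpha>)) * fourier \<phi> x)
       \<le> norm (C * (norm x powr (- \<alpha>) / (1 + (norm x)\<^sup>2) ^ DIM('a)))" .
    qed
  qed measurable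
  have "(\<integral>x. complex_of_real (norm x powr (- \<alpha>)) * fourier \<phi> x \<partial>lborel)
     = (\<integral>t. complex_of_real (subordinator \<alpha> t) * (\<integral>x. complex_of_real (gaussian t x) * fourier \<phi> x \<partial>lborel) \<partial>lborel)"
    by (rule integral_gaussian_mixture) (use \<alpha> in \<open>auto simp: subordinator_nonneg gaussian_nonneg riesz_kernel_subordination riesz_kernel_def int\<close>)
  also have "\<dots> = (\<integral>t. complex_of_real (subordinator \<alpha> t) * (\<integral>u. complex_of_real (gaussian_hat t u) * \<phi> u \<partial>lborel) \<partial>lborel)"
  proof (intro Bochner_Integration.integral_cong refl)
    fix t :: real
    show "complex_of_real (subordinator \<alpha> t) * (\<integral>x. complex_of_real (gaussian t x) * fourier \<phi> x \<partial>lborel)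
      = complex_of_real (subordinator \<alpha> t) * (\<integral>u. complex_of_real (gaussian_hat t u) * \<phi> u \<partial>lborel)"
    proof (cases "t > 0")
      case True
      have "integrable lborel (\<lambda>x::'a. complex_of_real (gaussian t x))"
        using nn_integral_gaussian(2)[OF True] by (simp add: complex_of_real_integrable_eq)
      from fourier_multiplication_formula[OF this schwartz_integrable[OF \<phi>]]
      show ?thesis by (simp add: fourier_gaussian[OF True])
    qed (simp add: subordinator_def)
  qed
  also have "\<dots> = (\<integral>u. complex_of_real (riesz_hat \<alpha> u) * \<phi> u \<partial>lborel)"
    by (rule integral_gaussian_mixture[symmetric])
      (use \<alpha> \<phi> tempered_riesz(2)[OF \<alpha>] in \<open>auto simp: subordinator_nonneg gaussian_hat_nonneg riesz_hat_subordination riesz_hat_nonneg tempered_function_def\<close>)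
  finally show ?thesis .
qed

section \<open>The energy as a frequency integral\<close>

text \<open>Fourier inversion writes \<open>gaussian t (x - y)\<close> as an integral of characters
  \<open>exp (\<i> * complex_of_real (u \<bullet> (x - y)))\<close>, and integrating such a character against the product measure
  gives \<open>(cmod (measure_fourier \<mu> u))\<^sup>2\<close>. Fubini applies because \<open>gaussian_hat t\<close> is integrable
  and \<open>\<mu>\<close> is finite.\<close>
lemma energy_gaussian:
  fixes \<mu> :: "'a::euclidean_space measure"
  assumes [measurable_cong]: "sets \<mu> = sets borel" and "finite_measure \<mu>" and t: "t > 0"
  shows "(\<integral>\<^sup>+x. \<integral>\<^sup>+y. ennreal (gaussian t (x - y)) \<partial>\<mu> \<partial>\<mu>)
     = ennreal (1 / (2 * pi) ^ DIM('a)) * (\<integral>\<^sup>+u. ennreal (gaussian_hat t u * (cmod (measure_fourier \<mu> u))\<^sup>2) \<partial>lborel)"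
proof -
  interpret finite_measure \<mu> by fact
  interpret PM: pair_sigma_finite \<mu> \<mu> ..
  interpret \<nu>: finite_measure "\<mu> \<Otimes>\<^sub>M \<mu>" by (rule finite_measure_pair_measure) fact+
  interpret P: pair_sigma_finite "lborel :: 'a measure" "\<mu> \<Otimes>\<^sub>M \<mu>" ..
  let ?e = "\<lambda>u x. exp (\<i> * complex_of_real (u \<bullet> x))"
  have eint: "integrable \<mu> (?e u)" for u
    by (rule integrable_const_bound[of _ 1]) auto
  have \<nu>int: "integrable (\<mu> \<Otimes>\<^sub>M \<mu>) (\<lambda>p. ?e u (fst p - snd p))" for u
    by (rule \<nu>.integrable_const_bound[of _ 1]) auto
  have sq: "complex_of_real ((cmod (measure_fourier \<mu> u))\<^sup>2) = (\<integral>p. ?e u (fst p - snd p) \<partial>(\<mu> \<Otimes>\<^sub>M \<mu>))" for u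
  proof -
    have c: "cnj (?e u y) = exp (- (\<i> * complex_of_real (u \<bullet> y)))" for y
      by (simp add: exp_cnj)
    have "complex_of_real ((cmod (measure_fourier \<mu> u))\<^sup>2) = measure_fourier \<mu> u * cnj (measure_fourier \<mu> u)"
      by (rule complex_norm_square)
    also have "cnj (measure_fourier \<mu> u) = (\<integral>y. cnj (?e u y) \<partial>\<mu>)"
      unfolding measure_fourier_def by (rule Bochner_Integration.integral_cnj[symmetric])
    also have "measure_fourier \<mu> u * (\<integral>y. cnj (?e u y) \<partial>\<mu>) = (\<integral>x. \<integral>y. ?e u x * cnj (?e u y) \<partial>\<mu> \<partial>\<mu>)"
      by (simp add: measure_fourier_def)
    also have "\<dots> = (\<integral>x. \<integral>y. ?e u (x - y) \<partial>\<mu> \<partial>\<mu>)"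
      unfolding c by (simp add: inner_diff_right right_diff_distrib flip: exp_add)
    also have "\<dots> = (\<integral>p. ?e u (fst p - snd p) \<partial>(\<mu> \<Otimes>\<^sub>M \<mu>))"
      using PM.integral_fst'[OF \<nu>int] by simp
    finally show ?thesis .
  qed
  have g: "integrable lborel (gaussian_hat t :: 'a \<Rightarrow> real)" by (rule inverse_fourier_gaussian_hat(2)[OF t])
  let ?F = "\<lambda>u (p::'a \<times> 'a). complex_of_real (gaussian_hat t u) * ?e u (fst p - snd p)"
  have prod: "integrable (lborel \<Otimes>\<^sub>M (\<mu> \<Otimes>\<^sub>M \<mu>)) (\<lambda>(u, p). ?F u p)"
  proof (rule P.Fubini_integrable)
    show "integrable lborel (\<lambda>u. \<integral>p. norm (case (u, p) of (u, p) \<Rightarrow> ?F u p) \<partial>(\<mu> \<Otimes>\<^sub>M \<mu>))"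
      using g by (simp add: norm_mult gaussian_hat_nonneg)
    show "AE u in lborel. integrable (\<mu> \<Otimes>\<^sub>M \<mu>) (\<lambda>p. case (u, p) of (u, p) \<Rightarrow> ?F u p)"
      using \<nu>int by (intro AE_I2) (simp only: prod.case integrable_mult_right)
  qed measurable
  have M: "integrable lborel (\<lambda>u. complex_of_real (gaussian_hat t u * (cmod (measure_fourier \<mu> u))\<^sup>2))"
    and E1: "(\<integral>u. complex_of_real (gaussian_hat t u * (cmod (measure_fourier \<mu> u))\<^sup>2) \<partial>lborel)
       = (\<integral>p. complex_of_real ((2 * pi) ^ DIM('a) * gaussian t (fst p - snd p)) \<partial>(\<mu> \<Otimes>\<^sub>M \<mu>))"
  proof -
    have eq: "complex_of_real (gaussian_hat t u * (cmod (measure_fourier \<mu> u))\<^sup>2) = (\<integral>p. ?F u p \<partial>(\<mu> \<Otimes>\<^sub>M \<mu>))" for u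
      unfolding of_real_mult sq by simp
    show "integrable lborel (\<lambda>u. complex_of_real (gaussian_hat t u * (cmod (measure_fourier \<mu> u))\<^sup>2))"
      unfolding eq using P.integrable_fst[OF prod] by simp
    have "(\<integral>u. complex_of_real (gaussian_hat t u * (cmod (measure_fourier \<mu> u))\<^sup>2) \<partial>lborel)
       = (\<integral>p. (\<integral>u. ?F u p \<partial>lborel) \<partial>(\<mu> \<Otimes>\<^sub>M \<mu>))"
      unfolding eq using P.Fubini_integral[OF prod] by simp
    also have "\<dots> = (\<integral>p. complex_of_real ((2 * pi) ^ DIM('a) * gaussian t (fst p - snd p)) \<partial>(\<mu> \<Otimes>\<^sub>M \<mu>))"
      by (subst mult.commute) (simp only: inverse_fourier_gaussian_hat(1)[OF t])
    finally show "(\<integral>u. complex_of_real (gaussian_hat t u * (cmod (measure_fourier \<mu> u))\<^sup>2) \<partial>lborel)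
       = (\<integral>p. complex_of_real ((2 * pi) ^ DIM('a) * gaussian t (fst p - snd p)) \<partial>(\<mu> \<Otimes>\<^sub>M \<mu>))" .
  qed
  have R: "(\<integral>u. gaussian_hat t u * (cmod (measure_fourier \<mu> u))\<^sup>2 \<partial>lborel)
       = (2 * pi) ^ DIM('a) * (\<integral>p. gaussian t (fst p - snd p) \<partial>(\<mu> \<Otimes>\<^sub>M \<mu>))"
    using E1 unfolding integral_complex_of_real of_real_eq_iff by simp
  have MR: "integrable lborel (\<lambda>u. gaussian_hat t u * (cmod (measure_fourier \<mu> u))\<^sup>2)"
    using M unfolding complex_of_real_integrable_eq .
  have gint: "integrable (\<mu> \<Otimes>\<^sub>M \<mu>) (\<lambda>p. gaussian t (fst p - snd p))"
    by (rule \<nu>.integrable_const_bound[of _ 1]) (use t in \<open>auto simp: gaussian_def\<close>)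
  have "(\<integral>\<^sup>+x. \<integral>\<^sup>+y. ennreal (gaussian t (x - y)) \<partial>\<mu> \<partial>\<mu>) = (\<integral>\<^sup>+p. ennreal (gaussian t (fst p - snd p)) \<partial>(\<mu> \<Otimes>\<^sub>M \<mu>))"
    by (subst nn_integral_fst[symmetric]) auto
  also have "\<dots> = ennreal (\<integral>p. gaussian t (fst p - snd p) \<partial>(\<mu> \<Otimes>\<^sub>M \<mu>))"
    by (rule nn_integral_eq_integral[OF gint]) (simp add: gaussian_nonneg)
  also have "\<dots> = ennreal (1 / (2 * pi) ^ DIM('a)) * ennreal (\<integral>u. gaussian_hat t u * (cmod (measure_fourier \<mu> u))\<^sup>2 \<partial>lborel)"
    unfolding R by (subst ennreal_mult[symmetric]) (auto simp: gaussian_nonneg intro!: mult_nonneg_nonneg Bochner_Integration.integral_nonneg)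
  also have "ennreal (\<integral>u. gaussian_hat t u * (cmod (measure_fourier \<mu> u))\<^sup>2 \<partial>lborel)
    = (\<integral>\<^sup>+u. ennreal (gaussian_hat t u * (cmod (measure_fourier \<mu> u))\<^sup>2) \<partial>lborel)"
    by (rule nn_integral_eq_integral[OF MR, symmetric]) (simp add: gaussian_hat_nonneg)
  finally show ?thesis .
qed

text \<open>All integrands are nonnegative, so Tonelli interchanges the mixture over \<open>t\<close> with the double
  integral on one side and with the frequency integral on the other, without regard to finiteness.\<close>
lemma riesz_energy_fourier:
  fixes \<mu> :: "'a::euclidean_space measure"
  assumes [measurable_cong]: "sets \<mu> = sets borel" and fin: "finite_measure \<mu>"
    and \<alpha>: "0 < \<alpha>" "\<alpha> < real DIM('a)"
  shows "riesz_energy \<alpha> \<mu> = ennreal (1 / (2 * pi) ^ DIM('a)) *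
      (\<integral>\<^sup>+u. ennreal (riesz_hat \<alpha> u * (cmod (measure_fourier \<mu> u))\<^sup>2) \<partial>lborel)"
proof -
  interpret finite_measure \<mu> by fact
  interpret \<nu>: finite_measure "\<mu> \<Otimes>\<^sub>M \<mu>" by (rule finite_measure_pair_measure) fact+
  interpret P: pair_sigma_finite "lborel :: real measure" "\<mu> \<Otimes>\<^sub>M \<mu>" ..
  have [measurable]: "measure_fourier \<mu> \<in> borel_measurable borel"
    unfolding measure_fourier_def[abs_def] by measurable
  let ?c = "ennreal (1 / (2 * pi) ^ DIM('a))"
  have "riesz_energy \<alpha> \<mu> = (\<integral>\<^sup>+x. \<integral>\<^sup>+y. (\<integral>\<^sup>+t. ennreal (subordinator \<alpha> t * gaussian t (x - y)) \<partial>lborel) \<partial>\<mu> \<partial>\<mu>)"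
    unfolding riesz_energy_def by (simp add: riesz_kernel_subordination \<alpha>)
  also have "\<dots> = (\<integral>\<^sup>+p. (\<integral>\<^sup>+t. ennreal (subordinator \<alpha> t * gaussian t (fst p - snd p)) \<partial>lborel) \<partial>(\<mu> \<Otimes>\<^sub>M \<mu>))"
  proof -
    have "(\<lambda>p. \<integral>\<^sup>+t. ennreal (subordinator \<alpha> t * gaussian t (fst p - snd p)) \<partial>lborel) \<in> borel_measurable (\<mu> \<Otimes>\<^sub>M \<mu>)"
      unfolding gaussian_def by measurable
    from nn_integral_fst[OF this] show ?thesis by simp
  qed
  also have "\<dots> = (\<integral>\<^sup>+t. (\<integral>\<^sup>+p. ennreal (subordinator \<alpha> t * gaussian t (fst p - snd p)) \<partial>(\<mu> \<Otimes>\<^sub>M \<mu>)) \<partial>lborel)"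
    unfolding gaussian_def by (rule P.Fubini') measurable
  also have "\<dots> = (\<integral>\<^sup>+t. ?c * (\<integral>\<^sup>+u. ennreal (subordinator \<alpha> t * gaussian_hat t u * (cmod (measure_fourier \<mu> u))\<^sup>2) \<partial>lborel) \<partial>lborel)"
  proof (rule nn_integral_cong)
    fix t :: real
    show "(\<integral>\<^sup>+p. ennreal (subordinator \<alpha> t * gaussian t (fst p - snd p)) \<partial>(\<mu> \<Otimes>\<^sub>M \<mu>))
      = ?c * (\<integral>\<^sup>+u. ennreal (subordinator \<alpha> t * gaussian_hat t u * (cmod (measure_fourier \<mu> u))\<^sup>2) \<partial>lborel)"
    proof (cases "t > 0")
      case True
      let ?s = "ennreal (subordinator \<alpha> t)"
      have "(\<integral>\<^sup>+p. ennreal (subordinator \<alpha> t * gaussian t (fst p - snd p)) \<partial>(\<mu> \<Otimes>\<^sub>M \<mu>))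
          = (\<integral>\<^sup>+p. ?s * ennreal (gaussian t (fst p - snd p)) \<partial>(\<mu> \<Otimes>\<^sub>M \<mu>))"
        using \<alpha> by (simp add: ennreal_mult subordinator_nonneg gaussian_nonneg)
      also have "\<dots> = ?s * (\<integral>\<^sup>+p. ennreal (gaussian t (fst p - snd p)) \<partial>(\<mu> \<Otimes>\<^sub>M \<mu>))"
        by (rule nn_integral_cmult) measurable
      also have "(\<integral>\<^sup>+p. ennreal (gaussian t (fst p - snd p)) \<partial>(\<mu> \<Otimes>\<^sub>M \<mu>)) = (\<integral>\<^sup>+x. \<integral>\<^sup>+y. ennreal (gaussian t (x - y)) \<partial>\<mu> \<partial>\<mu>)"
        by (subst nn_integral_fst[symmetric]) auto
      also have "\<dots> = ?c * (\<integral>\<^sup>+u. ennreal (gaussian_hat t u * (cmod (measure_fourier \<mu> u))\<^sup>2) \<partial>lborel)"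
        by (rule energy_gaussian[OF assms(1) fin True])
      also have "?s * (?c * (\<integral>\<^sup>+u. ennreal (gaussian_hat t u * (cmod (measure_fourier \<mu> u))\<^sup>2) \<partial>lborel))
          = ?c * (?s * (\<integral>\<^sup>+u. ennreal (gaussian_hat t u * (cmod (measure_fourier \<mu> u))\<^sup>2) \<partial>lborel))"
        by (rule mult.left_commute)
      also have "?s * (\<integral>\<^sup>+u. ennreal (gaussian_hat t u * (cmod (measure_fourier \<mu> u))\<^sup>2) \<partial>lborel)
          = (\<integral>\<^sup>+u. ?s * ennreal (gaussian_hat t u * (cmod (measure_fourier \<mu> u))\<^sup>2) \<partial>lborel)"
        by (rule nn_integral_cmult[symmetric]) measurable
      also have "\<dots> = (\<integral>\<^sup>+u. ennreal (subordinator \<alpha> t * gaussian_hat t u * (cmod (measure_fourier \<mu> u))\<^sup>2) \<partial>lborel)"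
        using \<alpha> by (simp add: ennreal_mult[symmetric] subordinator_nonneg gaussian_hat_nonneg mult.assoc)
      finally show ?thesis .
    qed (simp add: subordinator_def)
  qed
  also have "\<dots> = ?c * (\<integral>\<^sup>+t. (\<integral>\<^sup>+u. ennreal (subordinator \<alpha> t * gaussian_hat t u * (cmod (measure_fourier \<mu> u))\<^sup>2) \<partial>lborel) \<partial>lborel)"
    unfolding gaussian_hat_def by (rule nn_integral_cmult) measurable
  also have "(\<integral>\<^sup>+t. (\<integral>\<^sup>+u. ennreal (subordinator \<alpha> t * gaussian_hat t u * (cmod (measure_fourier \<mu> u))\<^sup>2) \<partial>lborel) \<partial>lborel)
     = (\<integral>\<^sup>+u. (\<integral>\<^sup>+t. ennreal (subordinator \<alpha> t * gaussian_hat t u * (cmod (measure_fourier \<mu> u))\<^sup>2) \<partial>lborel) \<partial>lborel)"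
    unfolding gaussian_hat_def by (rule lborel_pair.Fubini') measurable
  also have "\<dots> = (\<integral>\<^sup>+u. ennreal (riesz_hat \<alpha> u * (cmod (measure_fourier \<mu> u))\<^sup>2) \<partial>lborel)"
  proof (rule nn_integral_cong_AE)
    show "AE u in lborel. (\<integral>\<^sup>+t. ennreal (subordinator \<alpha> t * gaussian_hat t u * (cmod (measure_fourier \<mu> u))\<^sup>2) \<partial>lborel)
       = ennreal (riesz_hat \<alpha> u * (cmod (measure_fourier \<mu> u))\<^sup>2)"
      using AE_lborel_singleton[of "0::'a"]
    proof eventually_elim
      case (elim u)
      have "(\<integral>\<^sup>+t. ennreal (subordinator \<alpha> t * gaussian_hat t u * (cmod (measure_fourier \<mu> u))\<^sup>2) \<partial>lborel)
          = (\<integral>\<^sup>+t. ennreal (subordinator \<alpha> t * gaussian_hat t u) * ennreal ((cmod (measure_fourier \<mu> u))\<^sup>2) \<partial>lborel)"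
        using \<alpha> by (simp add: ennreal_mult subordinator_nonneg gaussian_hat_nonneg)
      also have "\<dots> = (\<integral>\<^sup>+t. ennreal (subordinator \<alpha> t * gaussian_hat t u) \<partial>lborel) * ennreal ((cmod (measure_fourier \<mu> u))\<^sup>2)"
        unfolding gaussian_hat_def by (rule nn_integral_multc) measurable
      finally show ?case
        using elim by (simp add: riesz_hat_subordination \<alpha> ennreal_mult riesz_hat_nonneg)
    qed
  qed
  finally show ?thesis .
qed

theorem theorem13:
  fixes \<mu> :: "(real ^ 'n) measure"
    and \<alpha> n :: real
    and khat :: "real ^ 'n \<Rightarrow> real"
  defines "n \<equiv> real CARD('n)"
  assumes "0 < \<alpha>" and "\<alpha> < n"
    and "radon_measure \<mu>" and "finite_measure \<mu>" and "compact (measure_support \<mu>)"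
    and khat: "\<And>u. u \<noteq> 0 \<Longrightarrow>
      khat u = pi powr (n / 2) * 2 powr (n - \<alpha>) * Gamma ((n - \<alpha>) / 2) / Gamma (\<alpha> / 2)
                 * norm u powr (\<alpha> - n)"
  shows "has_tempered_fourier
           (\<lambda>x :: real ^ 'n. complex_of_real (enn2real (riesz_kernel \<alpha> x)))
           (\<lambda>u. complex_of_real (khat u))
       \<and> riesz_energy \<alpha> \<mu> =
           ennreal (1 / (2 * pi) ^ CARD('n)) *
           (\<integral>\<^sup>+u. ennreal (khat u * (cmod (measure_fourier \<mu> u))\<^sup>2) \<partial>lborel)"
proof -
  have \<alpha>: "0 < \<alpha>" "\<alpha> < real DIM(real ^ 'n)" using assms by auto
  have sets: "sets \<mu> = sets borel" using assms by (simp add: radon_measure_def)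
  \<comment> \<open>at the origin both sides are 0, by the conventions for \<open>enn2real\<close> and \<open>powr\<close>\<close>
  have kernel: "enn2real (riesz_kernel \<alpha> x) = norm x powr (- \<alpha>)" for x :: "real ^ 'n"
    by (simp add: riesz_kernel_def)
  have eq: "khat u = riesz_hat \<alpha> u" if "u \<noteq> 0" for u
    using khat[OF that] by (simp add: riesz_hat_def n_def)
  \<comment> \<open>the value of \<open>khat\<close> at the origin is arbitrary, which affects neither measurability nor the integrals\<close>
  have khat_alt: "khat = (\<lambda>u. if u = 0 then khat 0 else riesz_hat \<alpha> u)"
    using eq by auto
  have [measurable]: "khat \<in> borel_measurable borel"
    by (subst khat_alt) measurable
  have AE: "AE u in lborel. khat u = riesz_hat \<alpha> u"
    using AE_lborel_singleton[of "0::real ^ 'n"] by eventually_elim (rule eq)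
  have "tempered_function (\<lambda>u. complex_of_real (khat u))"
  proof (rule tempered_function_if_riesz_bound)
    show "norm (complex_of_real (khat u)) \<le> pi powr (n / 2) * 2 powr (n - \<alpha>) * Gamma ((n - \<alpha>) / 2) / Gamma (\<alpha> / 2)
                 * norm u powr (- (n - \<alpha>))" if "u \<noteq> 0" for u
      using riesz_hat_nonneg[OF \<alpha>, of u] eq[OF that] khat[OF that] by simp
  qed (use assms in auto)
  moreover have "distribution_fourier (fun_distribution (\<lambda>x. complex_of_real (enn2real (riesz_kernel \<alpha> x)))) \<phi>
      = fun_distribution (\<lambda>u. complex_of_real (khat u)) \<phi>" if \<phi>: "\<phi> \<in> schwartz" for \<phi> :: "real ^ 'n \<Rightarrow> complex"
  proof -
    have [measurable]: "\<phi> \<in> borel_measurable borel" using \<phi> by (rule schwartz_measurable)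
    have "fun_distribution (\<lambda>u. complex_of_real (khat u)) \<phi> = (\<integral>u. complex_of_real (riesz_hat \<alpha> u) * \<phi> u \<partial>lborel)"
      unfolding fun_distribution_def by (rule integral_cong_AE) (use AE in auto)
    then show ?thesis
      using fourier_riesz[OF \<alpha> \<phi>] by (simp add: distribution_fourier_def fun_distribution_def kernel)
  qed
  moreover have "riesz_energy \<alpha> \<mu> = ennreal (1 / (2 * pi) ^ CARD('n)) *
           (\<integral>\<^sup>+u. ennreal (khat u * (cmod (measure_fourier \<mu> u))\<^sup>2) \<partial>lborel)"
  proof -
    have "(\<integral>\<^sup>+u. ennreal (khat u * (cmod (measure_fourier \<mu> u))\<^sup>2) \<partial>lborel)
       = (\<integral>\<^sup>+u. ennreal (riesz_hat \<alpha> u * (cmod (measure_fourier \<mu> u))\<^sup>2) \<partial>lborel)"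
      by (rule nn_integral_cong_AE) (use AE in eventually_elim, simp)
    then show ?thesis
      using riesz_energy_fourier[OF sets assms(5) \<alpha>] by simp
  qed
  ultimately show ?thesis
    unfolding has_tempered_fourier_def kernel using tempered_riesz(1)[OF \<alpha>] by blast
qed

end
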